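(* Let $n\ge2$. Suppose that the noise satisfies (A4) and the initial state $x(1)\in\mathbb{R}^n$ is not in consensus (its entries are not all equal). Let $\{\mathcal{G}(t)\}_{t\ge1}$ be any balanced and uniformly jointly connected topology sequence, with constant $c\ge1$. Then: (i) the fastest convergence rate $\inf_{a(1)\ge0,\dots,a(t-1)\ge0}E[V(x(t))]$ for this topology sequence is $\Theta\big(\frac1t\big)$; (ii) if one chooses $a(t)=\frac{\alpha}{t+t^*}$, where $\alpha$ and $t^*$ are constants satisfying $$\alpha\ge\frac{32n(n-1)^4c}{(2n-3)^2}\quad\text{and}\quad t^*\ge\lfloor2\alpha(n-1)a_{\max}\rfloor,$$ then the system reaches unbiased mean square average-consensus with rate $E[V(x(t))]=\Theta\big(\frac1t\big)$.
   Context: System. There are $n$ agents with scalar states $x_i(t)$, $t=1,2,\dots$, and deterministic initial state $x(1)\in\mathbb{R}^n$. At each time $t$ the topology is a weighted digraph $\mathcal{G}(t)=(\mathcal{V},\mathcal{E}(t),\mathcal{A}(t))$ without self-loops on $\mathcal{V}=\{1,\dots,n\}$; $\mathcal{N}_i(t)=\{j:(j,i)\in\mathcal{E}(t)\}$ is the neighbor set of $i$, and the edge $(j,i)$ has weight $a_{ij}^t$ with $1\le a_{ij}^t\le a_{\max}$ (standing assumption, $a_{\max}\ge1$ a constant). The dynamics is $$x_i(t+1)=x_i(t)+a(t)\sum_{j\in\mathcal{N}_i(t)}a_{ij}^t\,[x_j(t)-x_i(t)+w_{ji}(t)],\qquad t\ge1,\ 1\le i\le n,$$ where $a(t)\ge0$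 is the (deterministic) gain and $w_{ji}(t)$ are random noises. For $x\in\mathbb{R}^n$, $x_{\rm ave}=\frac1n\sum_i x_i$ and $V(x)=\sum_{i=1}^n(x_i-x_{\rm ave})^2$. Mean square consensus: there is a random variable $x^*$ with $|E x^*|<\infty$, $\mathrm{Var}(x^* )<\infty$ and $\lim_{t\to\infty}E\|x(t)-x^*\mathbf{1}\|^2=0$ ($\mathbf 1$ is the all-ones vector, $\|\cdot\|$ the Euclidean norm). Unbiased mean square average-consensus: in addition $E x^*=\frac1n\sum_{i=1}^n x_i(1)$. Uniformly jointly connected (with constant $c\ge1$): there is an infinite integer sequence $1=t_1<t_2<\cdots$ such that for all $k>1$, $t_k\le t_{k-1}+c$ and the union graph $\bigcup_{t_{k-1}\le t<t_k}\mathcal{G}(t)$ (union of the edge sets) is strongly connected. Balanced: for every $t\ge1$ and every node $i$, $\sum_{j:(j,i)\in\mathcal{E}(t)}a_{ij}^t=\sum_{j:(i,j)\in\mathcal{E}(t)}a_{ji}^t$. $g_1(t)=\Theta(g_2(t))$ means there are constants $c_2>c_1>0$ and $t_0>0$ with $c_1g_2(t)\le g_1(t)\le c_2g_2(t)$ for all $t\ge t_0$. (A4): there are constants $0<\underline v\le\overline v$ (independent of the topology sequence) such that for any topology sequence the noises $\{w_{ji}(t)\}$ are zero-mean random variables satisfying: (i) $E[w_{j_1i_1}(t_1)w_{j_2i_2}(t_2)]=0$ for all $t_1\ne t_2$, $(j_1,i_1)\in\mathcal{E}(t_1)$, $(j_2,i_2)\in\mathcal{E}(t_2)$; (ii) for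 any non-empty edge set $\mathcal{E}(t)$ and real numbers $\{c_{ji}\}$, $$\underline v\sum_{(j,i)\in\mathcal{E}(t)}c_{ji}^2\le E\Big[\sum_{(j,i)\in\mathcal{E}(t)}c_{ji}w_{ji}(t)\Big]^2\le\overline v\sum_{(j,i)\in\mathcal{E}(t)}c_{ji}^2 .$$ *)

theory Defs
  imports "HOL-Probability.Probability"
begin

text \<open>
  The agents are the elements of the finite type \<open>'n\<close>, so \<open>n\<close> is \<open>CARD('n)\<close>, and time is
  a natural number of which only \<open>t \<ge> 1\<close> is used.  The edge \<open>(j, i)\<close> carries the weight
  \<open>weight G i j\<close> (information flows from \<open>j\<close> to \<open>i\<close>); off the edge set the value of
  \<open>weight\<close> is irrelevant.
\<close>

record 'n wdigraph =
  edges :: "('n \<times> 'n) set"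
  weight :: "'n \<Rightarrow> 'n \<Rightarrow> real"

type_synonym 'n topology = "nat \<Rightarrow> 'n wdigraph"

definition topology_seq :: "real \<Rightarrow> 'n topology \<Rightarrow> bool" where
  "topology_seq amax G \<longleftrightarrow>
     (\<forall>t\<ge>1. (\<forall>i. (i, i) \<notin> edges (G t)) \<and>
            (\<forall>i j. (j, i) \<in> edges (G t) \<longrightarrow>
                   1 \<le> weight (G t) i j \<and> weight (G t) i j \<le> amax))"

definition neighbors :: "'n wdigraph \<Rightarrow> 'n \<Rightarrow> 'n set" where
  "neighbors H i = {j. (j, i) \<in> edges H}"

definition balanced :: "'n::finite topology \<Rightarrow> bool" where
  "balanced G \<longleftrightarrow>
     (\<forall>t\<ge>1. \<forall>i. (\<Sum>j | (j, i) \<in> edges (G t). weight (G t) i j) =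
                (\<Sum>j | (i, j) \<in> edges (G t). weight (G t) j i))"

definition strongly_connected_edges :: "('n \<times> 'n) set \<Rightarrow> bool" where
  "strongly_connected_edges E \<longleftrightarrow> (\<forall>u v. (u, v) \<in> E\<^sup>*)"

text \<open>The switching times are indexed from 1; \<open>\<tau> 0\<close> plays no role.\<close>

definition uniformly_jointly_connected :: "real \<Rightarrow> 'n topology \<Rightarrow> bool" where
  "uniformly_jointly_connected c G \<longleftrightarrow>
     (\<exists>\<tau> :: nat \<Rightarrow> nat. \<tau> 1 = 1 \<and> strict_mono_on {1..} \<tau> \<and>
        (\<forall>k>1. real (\<tau> k) \<le> real (\<tau> (k - 1)) + c \<and>
               strongly_connected_edges (\<Union>t\<in>{\<tau> (k - 1)..<\<tau> k}. edges (G t))))"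

text \<open>
  A noise assigns to each time \<open>t\<close> and each edge \<open>(j, i)\<close> a random variable \<open>w t j i\<close>.
  The noise may depend on the topology sequence, hence the family \<open>W\<close>; the two variance
  constants may not.  The integrability requirements express that the expectations below are
  genuine (the Bochner integral of a non-integrable function is 0).
\<close>

definition noise_A4 ::
  "'a measure \<Rightarrow> real \<Rightarrow> ('n::finite topology \<Rightarrow> nat \<Rightarrow> 'n \<Rightarrow> 'n \<Rightarrow> 'a \<Rightarrow> real) \<Rightarrow> bool" where
  "noise_A4 M amax W \<longleftrightarrow>
     (\<exists>vl vu. 0 < vl \<and> vl \<le> vu \<and>
       (\<forall>G. topology_seq amax G \<longrightarrow>
         (\<forall>t\<ge>1. \<forall>(j, i)\<in>edges (G t).
            integrable M (W G t j i) \<and> integrable M (\<lambda>\<omega>. (W G t j i \<omega>)\<^sup>2) \<and>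
            (\<integral>\<omega>. W G t j i \<omega> \<partial>M) = 0) \<and>
         (\<forall>t1\<ge>1. \<forall>t2\<ge>1. t1 \<noteq> t2 \<longrightarrow>
            (\<forall>(j1, i1)\<in>edges (G t1). \<forall>(j2, i2)\<in>edges (G t2).
               (\<integral>\<omega>. W G t1 j1 i1 \<omega> * W G t2 j2 i2 \<omega> \<partial>M) = 0)) \<and>
         (\<forall>t\<ge>1. edges (G t) \<noteq> {} \<longrightarrow>
            (\<forall>c :: 'n \<Rightarrow> 'n \<Rightarrow> real.
               vl * (\<Sum>(j, i)\<in>edges (G t). (c j i)\<^sup>2)
                 \<le> (\<integral>\<omega>. (\<Sum>(j, i)\<in>edges (G t). c j i * W G t j i \<omega>)\<^sup>2 \<partial>M) \<and>
               (\<integral>\<omega>. (\<Sum>(j, i)\<in>edges (G t). c j i * W G t j i \<omega>)\<^sup>2 \<partial>M)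
                 \<le> vu * (\<Sum>(j, i)\<in>edges (G t). (c j i)\<^sup>2)))))"

text \<open>
  The trajectory starts at time 1 with \<open>x1\<close>; the value at time 0 is a dummy.
\<close>

primrec state ::
  "'n::finite topology \<Rightarrow> (nat \<Rightarrow> 'n \<Rightarrow> 'n \<Rightarrow> 'a \<Rightarrow> real) \<Rightarrow> (nat \<Rightarrow> real) \<Rightarrow> real ^ 'n \<Rightarrow>
     nat \<Rightarrow> 'a \<Rightarrow> real ^ 'n" where
  "state G w a x1 0 = (\<lambda>\<omega>. x1)"
| "state G w a x1 (Suc t) = (\<lambda>\<omega>.
     if t = 0 then x1
     else (\<chi> i. state G w a x1 t \<omega> $ i +
            a t * (\<Sum>j\<in>neighbors (G t) i. weight (G t) i j *
                     (state G w a x1 t \<omega> $ j - state G w a x1 t \<omega> $ i + w t j i \<omega>))))"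

definition average :: "real ^ 'n \<Rightarrow> real" where
  "average x = (\<Sum>i\<in>UNIV. x $ i) / real CARD('n)"

definition V :: "real ^ 'n \<Rightarrow> real" where
  "V x = (\<Sum>i\<in>UNIV. (x $ i - average x)\<^sup>2)"

definition unbiased_ms_average_consensus ::
  "'a measure \<Rightarrow> real ^ 'n \<Rightarrow> (nat \<Rightarrow> 'a \<Rightarrow> real ^ 'n) \<Rightarrow> bool" where
  "unbiased_ms_average_consensus M x1 x \<longleftrightarrow>
     (\<exists>xs. integrable M xs \<and>
           integrable M (\<lambda>\<omega>. (xs \<omega> - (\<integral>\<omega>'. xs \<omega>' \<partial>M))\<^sup>2) \<and>
           (\<lambda>t. \<integral>\<^sup>+\<omega>. ennreal ((norm (x t \<omega> - xs \<omega> *\<^sub>R vec 1))\<^sup>2) \<partial>M) \<longlonglongrightarrow> 0 \<and>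
           (\<integral>\<omega>. xs \<omega> \<partial>M) = average x1)"

definition expected_V :: "'a measure \<Rightarrow> (nat \<Rightarrow> 'a \<Rightarrow> real ^ 'n) \<Rightarrow> nat \<Rightarrow> real" where
  "expected_V M x t = (\<integral>\<omega>. V (x t \<omega>) \<partial>M)"

text \<open>\<open>state G w a x1 t\<close> only depends on the gains \<open>a 1, \<dots>, a (t - 1)\<close>.\<close>

definition fastest_rate ::
  "'a measure \<Rightarrow> 'n::finite topology \<Rightarrow> (nat \<Rightarrow> 'n \<Rightarrow> 'n \<Rightarrow> 'a \<Rightarrow> real) \<Rightarrow> real ^ 'n \<Rightarrow>
     nat \<Rightarrow> real" where
  "fastest_rate M G w x1 t =
     (INF a\<in>{a. \<forall>s\<in>{1..<t}. 0 \<le> a s}. expected_V M (state G w a x1) t)"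

text \<open>Two-sided bounds without absolute values, unlike the library's \<open>bigtheta\<close>.\<close>

definition is_Theta :: "(nat \<Rightarrow> real) \<Rightarrow> (nat \<Rightarrow> real) \<Rightarrow> bool" where
  "is_Theta g1 g2 \<longleftrightarrow>
     (\<exists>c1 c2 t0. 0 < c1 \<and> c1 < c2 \<and> 0 < t0 \<and>
        (\<forall>t\<ge>t0. c1 * g2 t \<le> g1 t \<and> g1 t \<le> c2 * g2 t))"

end

theory Submission
  imports Defs
begin

text \<open>
  Write \<open>v t\<close> for the expectation of \<open>V\<close> of the state at time \<open>t\<close>.  The noise entering at
  time \<open>t\<close> is uncorrelated with the state it is added to, since the latter is an affine
  function of earlier noise.  Hence one step splits without a cross term: \<open>v (t + 1)\<close> is the
  expectation of \<open>V\<close> after the noiseless coupling step plus \<open>(a t)\<^sup>2\<close> times the expectation of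
  \<open>V\<close> of the noise vector (\<open>expected_V_step\<close>).  Everything else follows from estimating these
  two terms.

  No gain is faster than \<open>1 / t\<close>.  A coupling step of gain \<open>a\<close> shrinks the square root of
  \<open>V\<close> by a factor no smaller than \<open>1 - C * a\<close>, while it pays at least a constant times
  \<open>a\<^sup>2\<close> in noise.  Minimising the sum of the two contributions over \<open>a\<close> shows that \<open>1 / v\<close>
  grows by at most a fixed amount per step, whatever the gain (\<open>expected_V_step_ge\<close>).
  So \<open>1 / v t\<close> is at most linear in \<open>t\<close> (\<open>expected_V_lower_bound\<close>).

  The rate \<open>1 / t\<close> is attained.  On a balanced digraph the quadratic form of the coupling
  is a sum of squares over the edges, so a step of small gain reduces \<open>V\<close> by a multiple of
  this edge energy (\<open>V_step_le\<close>).  A single graph need not be connected, but any window of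
  \<open>N = 2 * nat \<lfloor>c\<rfloor>\<close> steps has a strongly connected union
  (\<open>uniformly_jointly_connected_window\<close>), and along shortest paths the energy of a strongly
  connected graph controls \<open>V\<close> up to the factor \<open>(n - 1)\<^sup>2\<close> (\<open>V_le_edge_energy\<close>).  Within a
  window the state moves only by an amount of the order of the gain, so the energies can all
  be evaluated at the initial state of the window at the price of an error of third order in
  the gain (\<open>expected_V_window_contraction\<close>).  For \<open>a t = \<alpha> / (t + tstar)\<close> the threshold on
  \<open>\<alpha>\<close> makes the contraction factor of a window eventually at most
  \<open>1 - (3 / 2) * N / (t + tstar)\<close>.  A coefficient above 1 is what
  forces a sequence with quadratically small perturbations to be of order \<open>1 / t\<close>
  (\<open>rate_of_window_recursion\<close>).

  Consensus.  The coupling does not move the average of a balanced network, so the average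
  is a sum of orthogonal increments whose variances are bounded by multiples of \<open>(a t)\<^sup>2\<close>.
  These are summable, so the average converges in mean square to a random variable whose
  mean is the initial average (\<open>average_converges_in_L2\<close>), and \<open>v t\<close> tends to 0.
\<close>

section \<open>Deviation from the average\<close>

definition center :: "real ^ 'n \<Rightarrow> real ^ 'n::finite" where
  "center x = (\<chi> i. x $ i - average x)"

lemma center_nth [simp]: "center x $ i = x $ i - average x"
  by (simp add: center_def)

lemma average_add: "average (x + y) = average x + average y"
  by (simp add: average_def sum.distrib add_divide_distrib)

lemma average_scaleR: "average (c *\<^sub>R x) = c * average x"
  by (simp add: average_def sum_distrib_left[symmetric])

lemma center_add: "center (x + y) = center x + center y"
  by (simp add: vec_eq_iff average_add)

lemma center_scaleR: "center (c *\<^sub>R x) = c *\<^sub>R center x"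
  by (simp add: vec_eq_iff average_scaleR right_diff_distrib)

lemma V_eq_norm: "V x = (norm (center x))\<^sup>2"
  unfolding power2_norm_eq_inner V_def inner_vec_def by (simp add: power2_eq_square)

lemma V_nonneg: "0 \<le> V x"
  by (simp add: V_eq_norm)

lemma sum_eq_average: "(\<Sum>i\<in>UNIV. x $ i) = real CARD('n) * average (x :: real ^ 'n::finite)"
  by (simp add: average_def)

lemma sum_center: "(\<Sum>i\<in>UNIV. center x $ i) = 0"
  by (simp add: sum_subtractf sum_eq_average)

lemma inner_center_center: "center x \<bullet> center y = center x \<bullet> y"
proof -
  have "center x \<bullet> center y = center x \<bullet> y - (\<Sum>i\<in>UNIV. center x $ i) * average y"
    unfolding inner_vec_def sum_distrib_right
    by (simp add: right_diff_distrib sum_subtractf)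
  then show ?thesis by (simp only: sum_center)
qed

lemma center_self_adjoint: "center x \<bullet> y = x \<bullet> center y"
  by (metis inner_center_center inner_commute)

text \<open>
  Pythagoras: the deviation from the average is orthogonal to the consensus vectors.  The
  mean-square error of consensus thus splits into \<open>V\<close> and the error of the average.
\<close>

lemma norm_sq_diff_consensus:
  fixes x :: "real ^ 'n::finite"
  shows "(norm (x - z *\<^sub>R vec 1))\<^sup>2 = V x + real CARD('n) * (average x - z)\<^sup>2"
proof -
  have "(norm (x - z *\<^sub>R vec 1))\<^sup>2 = (\<Sum>i\<in>UNIV. (center x $ i + (average x - z))\<^sup>2)"
    unfolding power2_norm_eq_inner inner_vec_def by (simp add: power2_eq_square)
  also have "\<dots> = (\<Sum>i\<in>UNIV. (center x $ i)\<^sup>2 + 2 * (average x - z) * center x $ i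
                 + (average x - z)\<^sup>2)"
    by (intro sum.cong refl) (simp add: power2_eq_square algebra_simps)
  also have "\<dots> = V x + 2 * (average x - z) * (\<Sum>i\<in>UNIV. center x $ i)
                 + real CARD('n) * (average x - z)\<^sup>2"
    by (simp add: sum.distrib sum_distrib_left V_def)
  finally show ?thesis by (simp only: sum_center)
qed

lemma V_le_sum_sq_diff:
  fixes x :: "real ^ 'n::finite"
  shows "V x \<le> (\<Sum>i\<in>UNIV. (x $ i - z)\<^sup>2)"
proof -
  have "(\<Sum>i\<in>UNIV. (x $ i - z)\<^sup>2) = (norm (x - z *\<^sub>R vec 1))\<^sup>2"
    unfolding power2_norm_eq_inner inner_vec_def by (simp add: power2_eq_square)
  then show ?thesis unfolding norm_sq_diff_consensus by simp
qed

lemma V_add: "V (x + y) = V x + V y + 2 * (center x \<bullet> y)"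
  unfolding V_eq_norm power2_norm_eq_inner
  by (simp add: center_add inner_add_left inner_add_right inner_center_center inner_commute)

lemma V_scaleR: "V (c *\<^sub>R x) = c\<^sup>2 * V x"
  by (simp add: V_eq_norm center_scaleR power_mult_distrib)

text \<open>
  Young's inequality for the seminorm whose square is \<open>V\<close>.  The parameter \<open>\<theta>\<close> is kept free
  because the lower bound on the rate needs its optimal value.
\<close>

lemma V_add_le:
  assumes "0 < \<theta>"
  shows "V (x + y) \<le> (1 + \<theta>) * (V x + V y / \<theta>)"
proof -
  have "0 \<le> (norm (\<theta> *\<^sub>R center x - center y))\<^sup>2 / \<theta>"
    using assms by simp
  also have "\<dots> = \<theta> * V x + V y / \<theta> - 2 * (center x \<bullet> y)"
    using assms unfolding V_eq_norm power2_norm_eq_inner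
    by (simp add: inner_diff_left inner_diff_right inner_center_center inner_commute
        field_simps)
  finally have "2 * (center x \<bullet> y) \<le> \<theta> * V x + V y / \<theta>" by simp
  then show ?thesis using assms by (simp add: V_add field_simps)
qed

lemma V_pos_iff: "0 < V x \<longleftrightarrow> (\<exists>i j. x $ i \<noteq> x $ j)"
proof
  assume "0 < V x"
  then have "center x \<noteq> 0" by (auto simp: V_eq_norm)
  show "\<exists>i j. x $ i \<noteq> x $ j"
  proof (rule ccontr)
    assume "\<not> ?thesis"
    then have eq: "x $ i = x $ undefined" for i by blast
    have "average x = x $ undefined"
      unfolding average_def by (subst sum.cong[OF refl eq]) simp
    with eq have "center x = 0" by (simp add: vec_eq_iff)
    with \<open>center x \<noteq> 0\<close> show False by simp
  qed
next
  assume "\<exists>i j. x $ i \<noteq> x $ j"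
  then have "center x \<noteq> 0" by (auto simp: vec_eq_iff) metis
  then show "0 < V x" by (simp add: V_eq_norm)
qed

lemma average_sq_le: "real CARD('n) * (average x)\<^sup>2 \<le> (norm (x :: real ^ 'n::finite))\<^sup>2"
  using norm_sq_diff_consensus[of x 0] V_nonneg[of x] by simp

lemma V_le_norm_sq: "V x \<le> (norm x)\<^sup>2"
  using norm_sq_diff_consensus[of x 0] by simp

lemma sq_le_V: "(center x $ i)\<^sup>2 \<le> V x"
  unfolding V_def by (simp) (rule member_le_sum[where f="\<lambda>i. (x $ i - average x)\<^sup>2"], auto)

section \<open>Dissipation on balanced digraphs\<close>

definition coupling :: "'n::finite wdigraph \<Rightarrow> real ^ 'n \<Rightarrow> real ^ 'n" where
  "coupling H x = (\<chi> i. \<Sum>j\<in>neighbors H i. weight H i j * (x $ j - x $ i))"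

definition disagreement :: "'n::finite wdigraph \<Rightarrow> real ^ 'n \<Rightarrow> real" where
  "disagreement H x = (\<Sum>(j, i)\<in>edges H. weight H i j * (x $ j - x $ i)\<^sup>2)"

definition edge_energy :: "('n \<times> 'n) set \<Rightarrow> real ^ 'n \<Rightarrow> real" where
  "edge_energy E x = (\<Sum>(j, i)\<in>E. (x $ j - x $ i)\<^sup>2)"

lemma edge_energy_nonneg: "0 \<le> edge_energy E x"
  unfolding edge_energy_def by (intro sum_nonneg) auto

lemma edge_energy_le_V:
  fixes x :: "real ^ 'n"
  shows "edge_energy E x \<le> 4 * real CARD('n) * V x"
proof -
  have "edge_energy E x \<le> edge_energy UNIV x"
    unfolding edge_energy_def by (intro sum_mono2) auto
  also have "\<dots> \<le> (\<Sum>(j, i)\<in>UNIV. 2 * (center x $ j)\<^sup>2 + 2 * (center x $ i)\<^sup>2)"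
    unfolding edge_energy_def
  proof (intro sum_mono, clarify)
    fix j i
    have "(x $ j - x $ i)\<^sup>2 = (center x $ j - center x $ i)\<^sup>2" by simp
    also have "\<dots> \<le> 2 * (center x $ j)\<^sup>2 + 2 * (center x $ i)\<^sup>2"
      using zero_le_power2[of "center x $ j + center x $ i"]
      unfolding power2_sum power2_diff by linarith
    finally show "(x $ j - x $ i)\<^sup>2 \<le> 2 * (center x $ j)\<^sup>2 + 2 * (center x $ i)\<^sup>2" .
  qed
  also have "\<dots> = (\<Sum>j\<in>UNIV. \<Sum>i\<in>UNIV. 2 * (center x $ j)\<^sup>2 + 2 * (center x $ i)\<^sup>2)"
    by (simp only: UNIV_Times_UNIV[symmetric] sum.cartesian_product)
  also have "\<dots> = 4 * real CARD('n) * V x"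
    by (simp add: sum.distrib sum_distrib_left[symmetric] V_def)
  finally show ?thesis .
qed

text \<open>
  Transfers the energy of a state to a nearby one, by \<open>(p - q)\<^sup>2 / 2 - q\<^sup>2 \<le> p\<^sup>2\<close> on each edge.
\<close>

lemma edge_energy_perturb:
  "edge_energy E x / 2 - edge_energy E (y - x) \<le> edge_energy E y"
proof -
  have "(x $ j - x $ i)\<^sup>2 / 2 - ((y - x) $ j - (y - x) $ i)\<^sup>2 \<le> (y $ j - y $ i)\<^sup>2" for i j
  proof -
    define p where "p = y $ j - y $ i"
    define q where "q = (y - x) $ j - (y - x) $ i"
    have "x $ j - x $ i = p - q" by (simp add: p_def q_def)
    moreover have "(p - q)\<^sup>2 / 2 - q\<^sup>2 \<le> p\<^sup>2"
      using zero_le_power2[of "p + q"] unfolding power2_sum power2_diff by (simp add: field_simps)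
    ultimately show ?thesis by (simp only: p_def q_def)
  qed
  then have "(\<Sum>(j, i)\<in>E. (x $ j - x $ i)\<^sup>2 / 2 - ((y - x) $ j - (y - x) $ i)\<^sup>2) \<le> edge_energy E y"
    unfolding edge_energy_def by (intro sum_mono) auto
  then show ?thesis
    by (simp add: edge_energy_def sum_subtractf sum_divide_distrib case_prod_unfold)
qed

lemma edge_energy_UN_le:
  fixes E :: "'i \<Rightarrow> ('n::finite \<times> 'n) set"
  assumes "finite I"
  shows "edge_energy (\<Union>i\<in>I. E i) x \<le> (\<Sum>i\<in>I. edge_energy (E i) x)"
  using assms
proof (induction I)
  case (insert i I)
  have "edge_energy (E i \<union> (\<Union>i\<in>I. E i)) x \<le> edge_energy (E i) x + edge_energy (\<Union>i\<in>I. E i) x"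
  proof -
    have "0 \<le> edge_energy (E i \<inter> (\<Union>i\<in>I. E i)) x"
      by (rule edge_energy_nonneg)
    then show ?thesis
      using sum.union_inter[of "E i" "\<Union>i\<in>I. E i" "\<lambda>(j, i). (x $ j - x $ i)\<^sup>2"]
      by (simp add: edge_energy_def)
  qed
  with insert show ?case by simp
qed (simp add: edge_energy_def)

lemma sum_neighbors:
  fixes H :: "'n::finite wdigraph"
  shows "(\<Sum>i\<in>UNIV. \<Sum>j\<in>neighbors H i. f j i) = (\<Sum>(j, i)\<in>edges H. f j i)"
proof -
  have "(\<Sum>i\<in>UNIV. \<Sum>j\<in>neighbors H i. f j i) = (\<Sum>(i, j)\<in>(SIGMA i:UNIV. neighbors H i). f j i)"
    by (rule sum.Sigma) auto
  also have "\<dots> = (\<Sum>(j, i)\<in>edges H. f j i)"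
    by (rule sum.reindex_bij_witness[of _ prod.swap prod.swap]) (auto simp: neighbors_def)
  finally show ?thesis .
qed

lemma sum_out_neighbors:
  fixes H :: "'n::finite wdigraph"
  shows "(\<Sum>j\<in>UNIV. \<Sum>i | (j, i) \<in> edges H. f j i) = (\<Sum>(j, i)\<in>edges H. f j i)"
proof -
  have "(\<Sum>j\<in>UNIV. \<Sum>i | (j, i) \<in> edges H. f j i)
      = (\<Sum>(j, i)\<in>(SIGMA j:UNIV. {i. (j, i) \<in> edges H}). f j i)"
    by (rule sum.Sigma) auto
  also have "(SIGMA j:UNIV. {i. (j, i) \<in> edges H}) = edges H" by auto
  finally show ?thesis .
qed

locale weighted_digraph =
  fixes H :: "'n::finite wdigraph" and amax :: real
  assumes loopless: "(i, i) \<notin> edges H"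
    and weight_ge: "(j, i) \<in> edges H \<Longrightarrow> 1 \<le> weight H i j"
    and weight_le: "(j, i) \<in> edges H \<Longrightarrow> weight H i j \<le> amax"
    and amax_ge: "1 \<le> amax"
begin

lemma card_neighbors: "real (card (neighbors H i)) \<le> real CARD('n) - 1"
proof -
  have "neighbors H i \<subseteq> UNIV - {i}" using loopless by (auto simp: neighbors_def)
  then have "card (neighbors H i) \<le> card (UNIV - {i})" by (intro card_mono) auto
  also have "\<dots> < CARD('n)" by (rule psubset_card_mono) auto
  finally show ?thesis by simp
qed

lemma edge_energy_le_disagreement: "edge_energy (edges H) x \<le> disagreement H x"
  unfolding disagreement_def edge_energy_def
proof (rule sum_mono, clarify)
  fix j i assume "(j, i) \<in> edges H"
  from mult_right_mono[OF weight_ge[OF this] zero_le_power2[of "x $ j - x $ i"]]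
  show "(x $ j - x $ i)\<^sup>2 \<le> weight H i j * (x $ j - x $ i)\<^sup>2" by simp
qed

text \<open>
  Cauchy-Schwarz at each node, which has at most \<open>n - 1\<close> neighbours; one factor \<open>weight\<close> is
  estimated by \<open>amax\<close>, the other one stays in the disagreement.
\<close>

lemma norm_coupling_le:
  "(norm (coupling H x))\<^sup>2 \<le> (real CARD('n) - 1) * amax * disagreement H x"
proof -
  let ?m = "real CARD('n) - 1"
  have "(norm (coupling H x))\<^sup>2 = (\<Sum>i\<in>UNIV. (\<Sum>j\<in>neighbors H i. weight H i j * (x $ j - x $ i))\<^sup>2)"
    unfolding power2_norm_eq_inner inner_vec_def coupling_def by (simp add: power2_eq_square)
  also have "\<dots> \<le> (\<Sum>i\<in>UNIV. \<Sum>j\<in>neighbors H i. ?m * amax * (weight H i j * (x $ j - x $ i)\<^sup>2))"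
  proof (rule sum_mono)
    fix i
    have "(\<Sum>j\<in>neighbors H i. weight H i j * (x $ j - x $ i))\<^sup>2
       \<le> (\<Sum>j\<in>neighbors H i. (weight H i j * (x $ j - x $ i))\<^sup>2) * real (card (neighbors H i))"
      using sum_squared_le_sum_of_squares
        [of "\<lambda>j. weight H i j * (x $ j - x $ i)" "neighbors H i"] by (simp add: mult.commute)
    also have "\<dots> \<le> (\<Sum>j\<in>neighbors H i. (weight H i j * (x $ j - x $ i))\<^sup>2) * ?m"
      using card_neighbors[of i] by (intro mult_left_mono sum_nonneg) auto
    also have "\<dots> \<le> (\<Sum>j\<in>neighbors H i. amax * (weight H i j * (x $ j - x $ i)\<^sup>2)) * ?m"
    proof (intro mult_right_mono sum_mono)
      fix j assume "j \<in> neighbors H i"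
      then have e: "(j, i) \<in> edges H" by (simp add: neighbors_def)
      have "weight H i j * weight H i j * (x $ j - x $ i)\<^sup>2
          \<le> amax * weight H i j * (x $ j - x $ i)\<^sup>2"
        using weight_ge[OF e] weight_le[OF e] by (intro mult_right_mono) auto
      then show "(weight H i j * (x $ j - x $ i))\<^sup>2 \<le> amax * (weight H i j * (x $ j - x $ i)\<^sup>2)"
        by (simp add: power2_eq_square mult_ac)
    qed auto
    also have "\<dots> = (\<Sum>j\<in>neighbors H i. ?m * amax * (weight H i j * (x $ j - x $ i)\<^sup>2))"
      unfolding sum_distrib_right by (intro sum.cong refl) (simp only: mult_ac)
    finally show "(\<Sum>j\<in>neighbors H i. weight H i j * (x $ j - x $ i))\<^sup>2 \<le> \<dots>" .
  qed
  also have "\<dots> = (\<Sum>(j, i)\<in>edges H. ?m * amax * (weight H i j * (x $ j - x $ i)\<^sup>2))"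
    by (rule sum_neighbors)
  also have "\<dots> = ?m * amax * disagreement H x"
    by (simp add: disagreement_def sum_distrib_left case_prod_unfold)
  finally show ?thesis .
qed

lemma disagreement_le_V: "disagreement H x \<le> 4 * real CARD('n) * amax * V x"
proof -
  have "disagreement H x \<le> (\<Sum>(j, i)\<in>edges H. amax * (x $ j - x $ i)\<^sup>2)"
    unfolding disagreement_def by (intro sum_mono) (auto intro!: mult_right_mono weight_le)
  also have "\<dots> = amax * edge_energy (edges H) x"
    by (simp add: edge_energy_def sum_distrib_left case_prod_unfold)
  also have "\<dots> \<le> amax * (4 * real CARD('n) * V x)"
    using amax_ge by (intro mult_left_mono edge_energy_le_V) auto
  finally show ?thesis by (simp add: mult_ac)
qed

lemma V_coupling_le:
  "V (coupling H x) \<le> (real CARD('n) - 1) * amax * (4 * real CARD('n) * amax) * V x"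
proof -
  have "V (coupling H x) \<le> (real CARD('n) - 1) * amax * disagreement H x"
    using V_le_norm_sq norm_coupling_le by (rule order_trans)
  also have "\<dots> \<le> (real CARD('n) - 1) * amax * (4 * real CARD('n) * amax * V x)"
    using amax_ge by (intro mult_left_mono disagreement_le_V) auto
  finally show ?thesis by (simp add: mult_ac)
qed

end

locale balanced_digraph = weighted_digraph H amax
  for H :: "'n::finite wdigraph" and amax +
  assumes balance: "(\<Sum>j | (j, i) \<in> edges H. weight H i j) = (\<Sum>j | (i, j) \<in> edges H. weight H j i)"
begin

text \<open>
  At each node the total incoming weight equals the total outgoing weight, so it does not
  matter at which end of the edges a function of the nodes is evaluated.
\<close>

lemma sum_edges_swap:
  fixes f :: "'n \<Rightarrow> real"
  shows "(\<Sum>(j, i)\<in>edges H. weight H i j * f j) = (\<Sum>(j, i)\<in>edges H. weight H i j * f i)"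
proof -
  have "(\<Sum>(j, i)\<in>edges H. weight H i j * f j)
      = (\<Sum>j\<in>UNIV. (\<Sum>i | (j, i) \<in> edges H. weight H i j) * f j)"
    by (simp add: sum_out_neighbors[symmetric] sum_distrib_right)
  also have "\<dots> = (\<Sum>i\<in>UNIV. (\<Sum>j\<in>neighbors H i. weight H i j) * f i)"
    by (simp add: balance[symmetric] neighbors_def)
  also have "\<dots> = (\<Sum>(j, i)\<in>edges H. weight H i j * f i)"
    by (simp add: sum_neighbors[symmetric] sum_distrib_right)
  finally show ?thesis .
qed

lemma average_coupling: "average (coupling H x) = 0"
proof -
  have "(\<Sum>i\<in>UNIV. coupling H x $ i) = (\<Sum>(j, i)\<in>edges H. weight H i j * (x $ j - x $ i))"
    by (simp add: coupling_def sum_neighbors)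
  also have "\<dots> = 0"
    using sum_edges_swap[of "\<lambda>i. x $ i"]
    by (simp add: right_diff_distrib sum_subtractf case_prod_unfold)
  finally show ?thesis by (simp add: average_def)
qed

text \<open>
  The coupling is minus the Laplacian, which need not be symmetric.  Balance symmetrises its
  quadratic form: the squares of the two endpoint values have equal weighted sums, and this
  completes the product to the square of a difference.
\<close>

lemma inner_coupling: "2 * (x \<bullet> coupling H x) = - disagreement H x"
proof -
  have "2 * (x \<bullet> coupling H x)
      = (\<Sum>i\<in>UNIV. \<Sum>j\<in>neighbors H i. 2 * (x $ i * (weight H i j * (x $ j - x $ i))))"
    by (simp add: inner_vec_def coupling_def sum_distrib_left)
  also have "\<dots> = (\<Sum>(j, i)\<in>edges H. 2 * (x $ i * (weight H i j * (x $ j - x $ i))))"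
    by (rule sum_neighbors)
  also have "\<dots> = (\<Sum>(j, i)\<in>edges H. weight H i j * (x $ j)\<^sup>2 - weight H i j * (x $ i)\<^sup>2
      - weight H i j * (x $ j - x $ i)\<^sup>2)"
    by (intro sum.cong) (auto simp: power2_eq_square algebra_simps)
  also have "\<dots> = - disagreement H x"
    using sum_edges_swap[of "\<lambda>i. (x $ i)\<^sup>2"]
    by (simp add: sum_subtractf case_prod_unfold disagreement_def)
  finally show ?thesis .
qed

text \<open>
  The first-order term is minus the disagreement by \<open>inner_coupling\<close>; the second-order term
  is a multiple of the same disagreement by \<open>norm_coupling_le\<close> and is absorbed when \<open>a\<close> is small.
\<close>

lemma V_step_le:
  "V (x + a *\<^sub>R coupling H x)
     \<le> V x - a * (1 - a * ((real CARD('n) - 1) * amax)) * disagreement H x"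
proof -
  have "center x \<bullet> coupling H x = x \<bullet> coupling H x"
  proof -
    have "center (coupling H x) = coupling H x" by (simp add: vec_eq_iff average_coupling)
    then show ?thesis by (simp add: center_self_adjoint)
  qed
  then have "V (x + a *\<^sub>R coupling H x)
      = V x - a * disagreement H x + a\<^sup>2 * V (coupling H x)"
    using inner_coupling[of x] by (simp add: V_add V_scaleR algebra_simps)
  also have "\<dots> \<le> V x - a * disagreement H x
      + a\<^sup>2 * ((real CARD('n) - 1) * amax * disagreement H x)"
    using order_trans[OF V_le_norm_sq norm_coupling_le] by (intro add_left_mono mult_left_mono) auto
  finally show ?thesis by (simp add: algebra_simps power2_eq_square)
qed

end

section \<open>Strongly connected unions\<close>

text \<open>
  A shortest path from \<open>u\<close> to \<open>v\<close> repeats no node, hence has at most \<open>n - 1\<close> edges, all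
  distinct.  Cauchy-Schwarz along the path gives the factor \<open>n - 1\<close>.
\<close>

lemma path_energy:
  fixes y :: "real ^ 'n::finite"
  assumes "(u, v) \<in> E\<^sup>*"
  shows "(y $ v - y $ u)\<^sup>2 \<le> (real CARD('n) - 1) * edge_energy E y"
proof -
  define k where "k = (LEAST k. (u, v) \<in> E ^^ k)"
  have k: "(u, v) \<in> E ^^ k"
    unfolding k_def using assms by (metis LeastI rtrancl_imp_relpow)
  have kmin: "k \<le> m" if "(u, v) \<in> E ^^ m" for m
    unfolding k_def using that by (rule Least_le)
  obtain f where f: "f 0 = u" "f k = v" "\<And>i. i < k \<Longrightarrow> (f i, f (Suc i)) \<in> E"
    using k unfolding relpow_fun_conv by auto
  have seg: "(f i, f (i + d)) \<in> E ^^ d" if "i + d \<le> k" for i d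
    unfolding relpow_fun_conv by (rule exI[of _ "\<lambda>l. f (i + l)"]) (use that f(3) in auto)
  \<comment> \<open>A repeated node would allow the loop between its two visits to be cut out.\<close>
  have neq: "f i \<noteq> f j" if "i < j" "j \<le> k" for i j
  proof
    assume eq: "f i = f j"
    have "(u, f i) \<in> E ^^ i" using seg[of 0 i] that f(1) by simp
    moreover have "(f i, v) \<in> E ^^ (k - j)" using seg[of j "k - j"] that f(2) eq by simp
    ultimately have "(u, v) \<in> E ^^ (i + (k - j))" by (auto simp: relpow_add)
    with kmin have "k \<le> i + (k - j)" by blast
    with that show False by simp
  qed
  have inj: "inj_on f {..k}"
    by (rule inj_onI) (metis atMost_iff linorder_neqE_nat neq)
  then have "card {..k} \<le> CARD('n)" by (metis card_image card_mono finite subset_UNIV)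
  then have k_le: "real k \<le> real CARD('n) - 1" by simp
  have "y $ v - y $ u = (\<Sum>i<k. y $ f (Suc i) - y $ f i)"
    by (simp add: sum_lessThan_telescope[of "\<lambda>i. y $ f i"] f)
  then have "(y $ v - y $ u)\<^sup>2 \<le> (\<Sum>i<k. (y $ f (Suc i) - y $ f i)\<^sup>2) * real k"
    using sum_squared_le_sum_of_squares[of "\<lambda>i. y $ f (Suc i) - y $ f i" "{..<k}"] by simp
  also have "(\<Sum>i<k. (y $ f (Suc i) - y $ f i)\<^sup>2)
      = (\<Sum>(p, q)\<in>(\<lambda>i. (f i, f (Suc i))) ` {..<k}. (y $ p - y $ q)\<^sup>2)"
    by (subst sum.reindex)
       (auto simp: power2_commute intro!: inj_onI dest: inj_onD[OF inj])
  also have "\<dots> \<le> edge_energy E y"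
    unfolding edge_energy_def by (rule sum_mono2) (auto simp: f(3))
  finally have "(y $ v - y $ u)\<^sup>2 \<le> edge_energy E y * real k"
    by (simp add: mult_right_mono)
  also have "\<dots> \<le> edge_energy E y * (real CARD('n) - 1)"
    by (rule mult_left_mono[OF k_le]) (rule edge_energy_nonneg)
  finally show ?thesis by (simp add: mult.commute)
qed

text \<open>
  Deviations from the value at a fixed node dominate deviations from the average, and the
  fixed node itself contributes nothing; this leaves \<open>n - 1\<close> terms of size \<open>n - 1\<close> energies.
\<close>

lemma V_le_edge_energy:
  fixes y :: "real ^ 'n::finite"
  assumes "strongly_connected_edges E"
  shows "V y \<le> (real CARD('n) - 1)\<^sup>2 * edge_energy E y"
proof -
  fix u :: 'n
  have "V y \<le> (\<Sum>i\<in>UNIV. (y $ i - y $ u)\<^sup>2)" by (rule V_le_sum_sq_diff)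
  also have "\<dots> = (\<Sum>i\<in>UNIV - {u}. (y $ i - y $ u)\<^sup>2)"
    by (rule sum.mono_neutral_right) auto
  also have "\<dots> \<le> (\<Sum>i\<in>UNIV - {u}. (real CARD('n) - 1) * edge_energy E y)"
    using assms by (intro sum_mono path_energy) (auto simp: strongly_connected_edges_def)
  also have "\<dots> = (real CARD('n) - 1)\<^sup>2 * edge_energy E y"
    by (simp add: power2_eq_square of_nat_diff card_Diff_singleton Suc_leI)
  finally show ?thesis .
qed

lemma strongly_connected_edges_mono:
  "strongly_connected_edges E \<Longrightarrow> E \<subseteq> F \<Longrightarrow> strongly_connected_edges F"
  unfolding strongly_connected_edges_def using rtrancl_mono by blast

text \<open>
  Consecutive switching times differ by at most \<open>\<lfloor>c\<rfloor>\<close>.  The first switching time from \<open>t\<close> on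
  therefore comes within \<open>\<lfloor>c\<rfloor>\<close> steps, and the switching interval that starts there ends
  within \<open>\<lfloor>c\<rfloor>\<close> further steps.
\<close>

lemma uniformly_jointly_connected_window:
  assumes "uniformly_jointly_connected c G" and t: "1 \<le> t"
  shows "strongly_connected_edges (\<Union>s\<in>{t..<t + 2 * nat \<lfloor>c\<rfloor>}. edges (G s))"
proof -
  obtain \<tau> :: "nat \<Rightarrow> nat" where \<tau>: "\<tau> 1 = 1" "strict_mono_on {1..} \<tau>"
    and gap: "\<And>k. 1 < k \<Longrightarrow> real (\<tau> k) \<le> real (\<tau> (k - 1)) + c"
    and conn: "\<And>k. 1 < k \<Longrightarrow> strongly_connected_edges (\<Union>s\<in>{\<tau> (k - 1)..<\<tau> k}. edges (G s))"
    using assms(1) unfolding uniformly_jointly_connected_def by blast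
  have gap': "\<tau> k \<le> \<tau> (k - 1) + nat \<lfloor>c\<rfloor>" if "1 < k" for k
    using gap[OF that] by linarith
  have ge: "k \<le> \<tau> k" if "1 \<le> k" for k
    using that
  proof (induction k rule: dec_induct)
    case (step k)
    then show ?case using strict_mono_onD[OF \<tau>(2), of k "Suc k"] by simp
  qed (use \<tau>(1) in simp)
  define k where "k = (LEAST k. 1 \<le> k \<and> t \<le> \<tau> k)"
  have k: "1 \<le> k" "t \<le> \<tau> k"
    using LeastI[of "\<lambda>k. 1 \<le> k \<and> t \<le> \<tau> k" t] ge[OF t] t unfolding k_def by auto
  have "\<tau> k \<le> t + nat \<lfloor>c\<rfloor>"
  proof (cases "k = 1")
    case True
    then show ?thesis using \<tau>(1) t by simp
  next
    case False
    then have "1 \<le> k - 1" "k - 1 < k" using k(1) by auto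
    then have "\<tau> (k - 1) < t" using not_less_Least[of "k - 1" "\<lambda>k. 1 \<le> k \<and> t \<le> \<tau> k"] unfolding k_def by auto
    then show ?thesis using gap'[of k] False k(1) by simp
  qed
  then have "{\<tau> k..<\<tau> (k + 1)} \<subseteq> {t..<t + 2 * nat \<lfloor>c\<rfloor>}"
    using k gap'[of "k + 1"] by (auto intro: order_trans less_le_trans)
  moreover have "strongly_connected_edges (\<Union>s\<in>{\<tau> k..<\<tau> (k + 1)}. edges (G s))"
    using conn[of "k + 1"] k(1) by simp
  ultimately show ?thesis by (meson UN_mono strongly_connected_edges_mono subset_refl)
qed

section \<open>Square-integrable random variables\<close>

definition square_integrable :: "'a measure \<Rightarrow> ('a \<Rightarrow> real) \<Rightarrow> bool" where
  "square_integrable M f \<longleftrightarrow> f \<in> borel_measurable M \<and> integrable M (\<lambda>\<omega>. (f \<omega>)\<^sup>2)"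

text \<open>
  Square integrability is part of the notion: it makes the product integrable, whereas the
  integral of a non-integrable product is 0 by convention.
\<close>

definition orthogonal_in_L2 :: "'a measure \<Rightarrow> ('a \<Rightarrow> real) \<Rightarrow> ('a \<Rightarrow> real) \<Rightarrow> bool" where
  "orthogonal_in_L2 M u f \<longleftrightarrow>
     square_integrable M u \<and> square_integrable M f \<and> (\<integral>\<omega>. u \<omega> * f \<omega> \<partial>M) = 0"

lemma square_integrable_measurable [measurable_dest]:
  "square_integrable M f \<Longrightarrow> f \<in> borel_measurable M"
  by (simp add: square_integrable_def)

lemma integrable_square: "square_integrable M f \<Longrightarrow> integrable M (\<lambda>\<omega>. (f \<omega>)\<^sup>2)"
  by (simp add: square_integrable_def)

lemma integrable_mult_square_integrable:
  assumes "square_integrable M f" "square_integrable M g"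
  shows "integrable M (\<lambda>\<omega>. f \<omega> * g \<omega>)"
proof (rule Bochner_Integration.integrable_bound)
  show "integrable M (\<lambda>\<omega>. (f \<omega>)\<^sup>2 + (g \<omega>)\<^sup>2)"
    using assms by (intro Bochner_Integration.integrable_add integrable_square)
  show "(\<lambda>\<omega>. f \<omega> * g \<omega>) \<in> borel_measurable M" using assms by measurable
  have "\<bar>f \<omega> * g \<omega>\<bar> \<le> (f \<omega>)\<^sup>2 + (g \<omega>)\<^sup>2" for \<omega>
  proof -
    have "0 \<le> (\<bar>f \<omega>\<bar> - \<bar>g \<omega>\<bar>)\<^sup>2" "0 \<le> (f \<omega>)\<^sup>2 + (g \<omega>)\<^sup>2" by auto
    then have "2 * (\<bar>f \<omega>\<bar> * \<bar>g \<omega>\<bar>) \<le> (f \<omega>)\<^sup>2 + (g \<omega>)\<^sup>2" unfolding power2_diff by simp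
    moreover have "0 \<le> \<bar>f \<omega>\<bar> * \<bar>g \<omega>\<bar>" by simp
    ultimately show ?thesis unfolding abs_mult by linarith
  qed
  then show "AE \<omega> in M. norm (f \<omega> * g \<omega>) \<le> norm ((f \<omega>)\<^sup>2 + (g \<omega>)\<^sup>2)" by simp
qed

lemma square_integrable_cmult:
  "square_integrable M f \<Longrightarrow> square_integrable M (\<lambda>\<omega>. c * f \<omega>)"
  unfolding square_integrable_def power_mult_distrib
  by (intro conjI borel_measurable_times borel_measurable_const integrable_mult_right) auto

lemma square_integrable_add:
  assumes "square_integrable M f" "square_integrable M g"
  shows "square_integrable M (\<lambda>\<omega>. f \<omega> + g \<omega>)"
  unfolding square_integrable_def power2_sum
proof
  show "(\<lambda>\<omega>. f \<omega> + g \<omega>) \<in> borel_measurable M" using assms by measurable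
  show "integrable M (\<lambda>\<omega>. (f \<omega>)\<^sup>2 + (g \<omega>)\<^sup>2 + 2 * f \<omega> * g \<omega>)"
    using integrable_square[OF assms(1)] integrable_square[OF assms(2)]
      integrable_mult_square_integrable[OF assms]
    by (simp add: mult.assoc)
qed

lemma square_integrable_diff:
  "square_integrable M f \<Longrightarrow> square_integrable M g \<Longrightarrow> square_integrable M (\<lambda>\<omega>. f \<omega> - g \<omega>)"
  using square_integrable_add[of M f "\<lambda>\<omega>. - 1 * g \<omega>"] square_integrable_cmult[of M g "- 1"]
  by simp

lemma square_integrable_sum:
  "(\<And>i. i \<in> I \<Longrightarrow> square_integrable M (f i)) \<Longrightarrow> square_integrable M (\<lambda>\<omega>. \<Sum>i\<in>I. f i \<omega>)"
proof (induction I rule: infinite_finite_induct)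
  case (insert i I)
  then show ?case by (simp add: square_integrable_add)
qed (simp_all add: square_integrable_def)

lemma (in finite_measure) square_integrable_const: "square_integrable M (\<lambda>\<omega>. c)"
  by (simp add: square_integrable_def)

lemma (in finite_measure) integrable_square_integrable:
  "square_integrable M f \<Longrightarrow> integrable M f"
  unfolding square_integrable_def by (rule square_integrable_imp_integrable) auto

lemma orthogonal_in_L2_commute: "orthogonal_in_L2 M u f \<longleftrightarrow> orthogonal_in_L2 M f u"
  by (auto simp: orthogonal_in_L2_def mult.commute)

lemma orthogonal_in_L2_cmult:
  "orthogonal_in_L2 M u f \<Longrightarrow> orthogonal_in_L2 M u (\<lambda>\<omega>. c * f \<omega>)"
  by (simp add: orthogonal_in_L2_def square_integrable_cmult mult.left_commute[of _ c])

lemma orthogonal_in_L2_add: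
  "orthogonal_in_L2 M u f \<Longrightarrow> orthogonal_in_L2 M u g \<Longrightarrow> orthogonal_in_L2 M u (\<lambda>\<omega>. f \<omega> + g \<omega>)"
  unfolding orthogonal_in_L2_def
  by (auto simp: square_integrable_add distrib_left integrable_mult_square_integrable)

lemma orthogonal_in_L2_diff:
  "orthogonal_in_L2 M u f \<Longrightarrow> orthogonal_in_L2 M u g \<Longrightarrow> orthogonal_in_L2 M u (\<lambda>\<omega>. f \<omega> - g \<omega>)"
  using orthogonal_in_L2_add[of M u f "\<lambda>\<omega>. - 1 * g \<omega>"] orthogonal_in_L2_cmult[of M u g "- 1"]
  by simp

lemma orthogonal_in_L2_sum:
  assumes "square_integrable M u" "\<And>i. i \<in> I \<Longrightarrow> orthogonal_in_L2 M u (f i)"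
  shows "orthogonal_in_L2 M u (\<lambda>\<omega>. \<Sum>i\<in>I. f i \<omega>)"
  using assms(2)
proof (induction I rule: infinite_finite_induct)
  case (insert i I)
  then show ?case by (simp add: orthogonal_in_L2_add)
qed (use assms(1) in \<open>simp_all add: orthogonal_in_L2_def square_integrable_def\<close>)

lemma integral_sq_add_orthogonal:
  assumes "orthogonal_in_L2 M f g"
  shows "(\<integral>\<omega>. (f \<omega> + g \<omega>)\<^sup>2 \<partial>M) = (\<integral>\<omega>. (f \<omega>)\<^sup>2 \<partial>M) + (\<integral>\<omega>. (g \<omega>)\<^sup>2 \<partial>M)"
  using assms integrable_mult_square_integrable[of M f g] integrable_square[of M f] integrable_square[of M g]
  unfolding orthogonal_in_L2_def power2_sum
  by (simp add: mult.assoc)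

lemma (in prob_space) expectation_sq_le:
  assumes "square_integrable M f"
  shows "(expectation f)\<^sup>2 \<le> expectation (\<lambda>\<omega>. (f \<omega>)\<^sup>2)"
proof -
  have "variance f = expectation (\<lambda>\<omega>. (f \<omega>)\<^sup>2) - (expectation f)\<^sup>2"
    by (rule variance_eq[OF integrable_square_integrable[OF assms] integrable_square[OF assms]])
  then show ?thesis using variance_positive[of f] by linarith
qed

text \<open>
  Completeness of \<open>L\<^sup>2\<close> with an explicit error.  Along a subsequence whose
  increments have second moments at most \<open>4\<^sup>-\<^sup>k\<close>, the increments are absolutely summable almost
  everywhere, because their first moments are at most \<open>2\<^sup>-\<^sup>k\<close>.  Fatou's lemma carries the error
  bound over to the pointwise limit.
\<close>

lemma (in prob_space) L2_Cauchy_limit: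
  fixes S :: "nat \<Rightarrow> 'a \<Rightarrow> real"
  assumes S: "\<And>t. square_integrable M (S t)"
    and cauchy: "\<And>r t. r \<le> t \<Longrightarrow> expectation (\<lambda>\<omega>. (S t \<omega> - S r \<omega>)\<^sup>2) \<le> e r"
    and e: "e \<longlonglongrightarrow> 0"
  obtains X where "square_integrable M X"
    and "\<And>r. expectation (\<lambda>\<omega>. (X \<omega> - S r \<omega>)\<^sup>2) \<le> e r"
proof -
  have [measurable]: "S t \<in> borel_measurable M" for t using S by (rule square_integrable_measurable)
  have diff: "square_integrable M (\<lambda>\<omega>. S t \<omega> - S r \<omega>)" for r t
    by (intro square_integrable_diff S)
  have e_nonneg: "0 \<le> e r" for r using cauchy[of r r] by simp
  have "\<exists>m. \<forall>r\<ge>m. e r < (1 / 4) ^ k" for k :: nat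
    using order_tendstoD(2)[OF e, of "(1 / 4) ^ k"] by (simp add: eventually_sequentially)
  then obtain m where m: "\<And>k r. m k \<le> r \<Longrightarrow> e r < (1 / 4) ^ k" by metis
  \<comment> \<open>The bound \<open>m k \<le> \<rho> k\<close> makes the subsequence fast, \<open>k \<le> \<rho> k\<close> keeps it cofinal.\<close>
  define \<rho> where "\<rho> k = (\<Sum>i\<le>k. m i) + k" for k
  have \<rho>_ge: "m k \<le> \<rho> k" "k \<le> \<rho> k" for k
    unfolding \<rho>_def by (auto intro: trans_le_add1 member_le_sum)
  have \<rho>_Suc: "\<rho> k \<le> \<rho> (Suc k)" for k by (simp add: \<rho>_def)
  define D where "D k \<omega> = S (\<rho> (Suc k)) \<omega> - S (\<rho> k) \<omega>" for k \<omega>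
  have [measurable]: "D k \<in> borel_measurable M" for k unfolding D_def by measurable
  have D: "square_integrable M (D k)" for k unfolding D_def by (rule diff)
  have ED: "(\<integral>\<^sup>+\<omega>. ennreal \<bar>D k \<omega>\<bar> \<partial>M) \<le> ennreal ((1 / 2) ^ k)" for k
  proof -
    let ?q = "2 ^ k :: real"
    \<comment> \<open>Arithmetic-geometric mean, balanced for \<open>D k\<close> of size \<open>1 / ?q\<close>.\<close>
    have "\<bar>D k \<omega>\<bar> \<le> (?q * (D k \<omega>)\<^sup>2 + 1 / ?q) / 2" for \<omega>
    proof -
      have "0 \<le> (?q * \<bar>D k \<omega>\<bar> - 1)\<^sup>2 / ?q" by simp
      also have "\<dots> = ?q * (D k \<omega>)\<^sup>2 + 1 / ?q - 2 * \<bar>D k \<omega>\<bar>"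
        by (simp add: power2_diff power_mult_distrib field_simps) (simp add: power2_eq_square)
      finally show ?thesis by simp
    qed
    then have "expectation (\<lambda>\<omega>. \<bar>D k \<omega>\<bar>) \<le> expectation (\<lambda>\<omega>. (?q * (D k \<omega>)\<^sup>2 + 1 / ?q) / 2)"
      using integrable_square[OF D] integrable_square_integrable[OF D]
      by (intro integral_mono) auto
    also have "\<dots> = (?q * expectation (\<lambda>\<omega>. (D k \<omega>)\<^sup>2) + 1 / ?q) / 2"
      using integrable_square[OF D] by (simp add: prob_space)
    also have "\<dots> \<le> (?q * (1 / 4) ^ k + 1 / ?q) / 2"
      using cauchy[OF \<rho>_Suc, of k] m[OF \<rho>_ge(1), of k] unfolding D_def by simp
    also have "\<dots> = (1 / 2) ^ k"
      by (simp add: power_divide field_simps flip: power_mult_distrib)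
    finally show ?thesis
      using integrable_square_integrable[OF D]
      by (subst nn_integral_eq_integral) (auto intro: ennreal_leI)
  qed
  have "(\<integral>\<^sup>+\<omega>. (\<Sum>k. ennreal \<bar>D k \<omega>\<bar>) \<partial>M) = (\<Sum>k. \<integral>\<^sup>+\<omega>. ennreal \<bar>D k \<omega>\<bar> \<partial>M)"
    by (rule nn_integral_suminf) measurable
  also have "\<dots> \<le> (\<Sum>k. ennreal ((1 / 2) ^ k))" by (intro suminf_le ED) auto
  also have "\<dots> < \<infinity>"
    by (subst suminf_ennreal2) auto
  finally have "AE \<omega> in M. (\<Sum>k. ennreal \<bar>D k \<omega>\<bar>) \<noteq> \<infinity>"
    by (intro nn_integral_PInf_AE) auto
  then have conv: "AE \<omega> in M. convergent (\<lambda>k. S (\<rho> k) \<omega>)"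
  proof eventually_elim
    case (elim \<omega>)
    then have "summable (\<lambda>k. \<bar>D k \<omega>\<bar>)" by (intro summable_suminf_not_top) auto
    then have "summable (\<lambda>k. D k \<omega>)" by (rule summable_rabs_cancel)
    then have "convergent (\<lambda>k. \<Sum>i<k. D i \<omega>)"
      using summable_LIMSEQ convergent_def by blast
    moreover have "(\<Sum>i<k. D i \<omega>) = S (\<rho> k) \<omega> - S (\<rho> 0) \<omega>" for k
      unfolding D_def by (rule sum_lessThan_telescope)
    ultimately have "convergent (\<lambda>k. S (\<rho> 0) \<omega> + (S (\<rho> k) \<omega> - S (\<rho> 0) \<omega>))"
      by (intro convergent_add convergent_const) simp
    then show ?case by simp
  qed
  define X where "X \<omega> = lim (\<lambda>k. S (\<rho> k) \<omega>)" for \<omega>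
  have [measurable]: "X \<in> borel_measurable M" unfolding X_def by (rule borel_measurable_lim_metric) measurable
  have fatou: "(\<integral>\<^sup>+\<omega>. ennreal ((X \<omega> - S r \<omega>)\<^sup>2) \<partial>M) \<le> ennreal (e r)" for r
  proof -
    have "AE \<omega> in M. ennreal ((X \<omega> - S r \<omega>)\<^sup>2)
        = liminf (\<lambda>k. ennreal ((S (\<rho> k) \<omega> - S r \<omega>)\<^sup>2))"
      using conv
    proof eventually_elim
      case (elim \<omega>)
      then have "(\<lambda>k. S (\<rho> k) \<omega>) \<longlonglongrightarrow> X \<omega>" unfolding X_def by (simp add: convergent_LIMSEQ_iff)
      then have "(\<lambda>k. ennreal ((S (\<rho> k) \<omega> - S r \<omega>)\<^sup>2)) \<longlonglongrightarrow> ennreal ((X \<omega> - S r \<omega>)\<^sup>2)"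
        by (intro tendsto_intros)
      then show ?case by (rule lim_imp_Liminf[OF trivial_limit_sequentially, symmetric])
    qed
    then have "(\<integral>\<^sup>+\<omega>. ennreal ((X \<omega> - S r \<omega>)\<^sup>2) \<partial>M)
        = (\<integral>\<^sup>+\<omega>. liminf (\<lambda>k. ennreal ((S (\<rho> k) \<omega> - S r \<omega>)\<^sup>2)) \<partial>M)"
      by (rule nn_integral_cong_AE)
    also have "\<dots> \<le> liminf (\<lambda>k. \<integral>\<^sup>+\<omega>. ennreal ((S (\<rho> k) \<omega> - S r \<omega>)\<^sup>2) \<partial>M)"
      by (rule nn_integral_liminf) measurable
    also have "\<dots> \<le> liminf (\<lambda>k :: nat. ennreal (e r))"
    proof (rule Liminf_mono)
      show "\<forall>\<^sub>F k in sequentially. (\<integral>\<^sup>+\<omega>. ennreal ((S (\<rho> k) \<omega> - S r \<omega>)\<^sup>2) \<partial>M) \<le> ennreal (e r)"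
        using eventually_ge_at_top[of r]
      proof eventually_elim
        case (elim k)
        then have "r \<le> \<rho> k" using \<rho>_ge(2)[of k] by simp
        then show ?case
          using cauchy[of r "\<rho> k"] integrable_square[OF diff, of "\<rho> k" r]
          by (subst nn_integral_eq_integral) (auto intro: ennreal_leI)
      qed
    qed
    also have "\<dots> = ennreal (e r)" by (simp add: Liminf_const)
    finally show ?thesis .
  qed
  have XS: "square_integrable M (\<lambda>\<omega>. X \<omega> - S r \<omega>)" for r
    unfolding square_integrable_def
  proof
    show "integrable M (\<lambda>\<omega>. (X \<omega> - S r \<omega>)\<^sup>2)"
      using fatou[of r] by (intro integrableI_bounded) (auto intro: le_less_trans)
  qed measurable
  have "square_integrable M X"
    using square_integrable_add[OF XS[of 0] S[of 0]] by simp
  moreover have "expectation (\<lambda>\<omega>. (X \<omega> - S r \<omega>)\<^sup>2) \<le> e r" for r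
    using fatou[of r] integrable_square[OF XS, of r] e_nonneg[of r]
    by (subst (asm) nn_integral_eq_integral) (auto)
  ultimately show thesis by (rule that)
qed

section \<open>Networks driven by uncorrelated noise\<close>

definition square_integrable_vec :: "'a measure \<Rightarrow> ('a \<Rightarrow> real ^ 'n) \<Rightarrow> bool" where
  "square_integrable_vec M X \<longleftrightarrow> (\<forall>i. square_integrable M (\<lambda>\<omega>. X \<omega> $ i))"

definition uncorrelated_vec :: "'a measure \<Rightarrow> ('a \<Rightarrow> real) \<Rightarrow> ('a \<Rightarrow> real ^ 'n) \<Rightarrow> bool" where
  "uncorrelated_vec M u X \<longleftrightarrow> (\<forall>i. orthogonal_in_L2 M u (\<lambda>\<omega>. X \<omega> $ i))"

definition noise_input :: "'n::finite wdigraph \<Rightarrow> ('n \<Rightarrow> 'n \<Rightarrow> 'a \<Rightarrow> real) \<Rightarrow> 'a \<Rightarrow> real ^ 'n" where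
  "noise_input H u \<omega> = (\<chi> i. \<Sum>j\<in>neighbors H i. weight H i j * u j i \<omega>)"

lemma square_integrable_vecD: "square_integrable_vec M X \<Longrightarrow> square_integrable M (\<lambda>\<omega>. X \<omega> $ i)"
  by (simp add: square_integrable_vec_def)

lemma square_integrable_vec_add:
  "square_integrable_vec M X \<Longrightarrow> square_integrable_vec M Y \<Longrightarrow> square_integrable_vec M (\<lambda>\<omega>. X \<omega> + Y \<omega>)"
  by (simp add: square_integrable_vec_def square_integrable_add)

lemma square_integrable_vec_diff:
  "square_integrable_vec M X \<Longrightarrow> square_integrable_vec M Y \<Longrightarrow> square_integrable_vec M (\<lambda>\<omega>. X \<omega> - Y \<omega>)"
  by (simp add: square_integrable_vec_def square_integrable_diff)

lemma square_integrable_vec_scaleR: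
  "square_integrable_vec M X \<Longrightarrow> square_integrable_vec M (\<lambda>\<omega>. c *\<^sub>R X \<omega>)"
  by (simp add: square_integrable_vec_def square_integrable_cmult)

lemma square_integrable_vec_coupling:
  "square_integrable_vec M X \<Longrightarrow> square_integrable_vec M (\<lambda>\<omega>. coupling H (X \<omega>))"
  unfolding square_integrable_vec_def coupling_def
  by (auto intro!: square_integrable_sum square_integrable_cmult square_integrable_diff)

lemma square_integrable_average:
  fixes X :: "'a \<Rightarrow> real ^ 'n::finite"
  assumes "square_integrable_vec M X"
  shows "square_integrable M (\<lambda>\<omega>. average (X \<omega>))"
proof -
  have "square_integrable M (\<lambda>\<omega>. (1 / real CARD('n)) * (\<Sum>i\<in>UNIV. X \<omega> $ i))"
    using assms unfolding square_integrable_vec_def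
    by (intro square_integrable_cmult square_integrable_sum) auto
  then show ?thesis by (simp add: average_def)
qed

lemma integrable_V: "square_integrable_vec M X \<Longrightarrow> integrable M (\<lambda>\<omega>. V (X \<omega>))"
  unfolding V_def
  by (intro Bochner_Integration.integrable_sum integrable_square square_integrable_diff
      square_integrable_average square_integrable_vecD)

lemma integrable_edge_energy:
  fixes X :: "'a \<Rightarrow> real ^ 'n::finite"
  shows "square_integrable_vec M X \<Longrightarrow> integrable M (\<lambda>\<omega>. edge_energy E (X \<omega>))"
  unfolding edge_energy_def case_prod_unfold
  by (intro Bochner_Integration.integrable_sum integrable_square square_integrable_diff
      square_integrable_vecD)

lemma uncorrelated_vecD: "uncorrelated_vec M u X \<Longrightarrow> orthogonal_in_L2 M u (\<lambda>\<omega>. X \<omega> $ i)"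
  by (simp add: uncorrelated_vec_def)

lemma uncorrelated_vec_add:
  "uncorrelated_vec M u X \<Longrightarrow> uncorrelated_vec M u Y \<Longrightarrow> uncorrelated_vec M u (\<lambda>\<omega>. X \<omega> + Y \<omega>)"
  by (simp add: uncorrelated_vec_def orthogonal_in_L2_add)

lemma uncorrelated_vec_scaleR:
  "uncorrelated_vec M u X \<Longrightarrow> uncorrelated_vec M u (\<lambda>\<omega>. c *\<^sub>R X \<omega>)"
  by (simp add: uncorrelated_vec_def orthogonal_in_L2_cmult)

lemma uncorrelated_vec_coupling:
  assumes "square_integrable M u" "uncorrelated_vec M u X"
  shows "uncorrelated_vec M u (\<lambda>\<omega>. coupling H (X \<omega>))"
  using assms(2) unfolding uncorrelated_vec_def coupling_def
  by (auto intro!: orthogonal_in_L2_sum orthogonal_in_L2_cmult orthogonal_in_L2_diff assms(1))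

lemma orthogonal_average:
  fixes X :: "'a \<Rightarrow> real ^ 'n::finite"
  assumes "square_integrable M u" "uncorrelated_vec M u X"
  shows "orthogonal_in_L2 M u (\<lambda>\<omega>. average (X \<omega>))"
proof -
  have "orthogonal_in_L2 M u (\<lambda>\<omega>. (1 / real CARD('n)) * (\<Sum>i\<in>UNIV. X \<omega> $ i))"
    using assms unfolding uncorrelated_vec_def
    by (intro orthogonal_in_L2_cmult orthogonal_in_L2_sum) auto
  then show ?thesis by (simp add: average_def)
qed

lemma uncorrelated_vec_noise_input:
  assumes "square_integrable M u"
    and "\<And>j i. (j, i) \<in> edges H \<Longrightarrow> orthogonal_in_L2 M u (q j i)"
  shows "uncorrelated_vec M u (noise_input H q)"
  unfolding uncorrelated_vec_def noise_input_def
  by (auto intro!: orthogonal_in_L2_sum orthogonal_in_L2_cmult assms simp: neighbors_def)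

text \<open>
  Linear functionals of the noise vector are linear combinations of the edge noises, which
  is the form in which the noise assumption bounds second moments.
\<close>

lemma inner_noise_input:
  "z \<bullet> noise_input H u \<omega> = (\<Sum>(j, i)\<in>edges H. (z $ i * weight H i j) * u j i \<omega>)"
  by (simp add: inner_vec_def noise_input_def sum_distrib_left mult.assoc sum_neighbors)

text \<open>
  All reasoning about the trajectory goes through its vector form \<open>state_step\<close>; unfolding the
  recursion componentwise would destroy it.
\<close>

declare state.simps [simp del]

text \<open>
  What the noise assumption provides for one topology sequence.  The variance bounds extend
  to empty edge sets, where both sides vanish.
\<close>

locale noisy_network = prob_space M for M :: "'a measure" +
  fixes G :: "'n::finite topology"
    and w :: "nat \<Rightarrow> 'n \<Rightarrow> 'n \<Rightarrow> 'a \<Rightarrow> real"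
    and amax vl vu :: real
  assumes graph: "1 \<le> t \<Longrightarrow> balanced_digraph (G t) amax"
    and noise_L2: "1 \<le> t \<Longrightarrow> (j, i) \<in> edges (G t) \<Longrightarrow> square_integrable M (w t j i)"
    and noise_mean: "1 \<le> t \<Longrightarrow> (j, i) \<in> edges (G t) \<Longrightarrow> expectation (w t j i) = 0"
    and noise_uncorrelated: "1 \<le> s \<Longrightarrow> 1 \<le> t \<Longrightarrow> s \<noteq> t \<Longrightarrow> (j, i) \<in> edges (G s) \<Longrightarrow>
        (j', i') \<in> edges (G t) \<Longrightarrow> expectation (\<lambda>\<omega>. w s j i \<omega> * w t j' i' \<omega>) = 0"
    and noise_lower: "1 \<le> t \<Longrightarrow> vl * (\<Sum>(j, i)\<in>edges (G t). (k j i)\<^sup>2)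
        \<le> expectation (\<lambda>\<omega>. (\<Sum>(j, i)\<in>edges (G t). k j i * w t j i \<omega>)\<^sup>2)"
    and noise_upper: "1 \<le> t \<Longrightarrow> expectation (\<lambda>\<omega>. (\<Sum>(j, i)\<in>edges (G t). k j i * w t j i \<omega>)\<^sup>2)
        \<le> vu * (\<Sum>(j, i)\<in>edges (G t). (k j i)\<^sup>2)"
    and vl_pos: "0 < vl" and vu_pos: "0 < vu"
    and two_nodes: "2 \<le> CARD('n)"
begin

abbreviation coupling_noise :: "nat \<Rightarrow> 'a \<Rightarrow> real ^ 'n" ("\<nu>") where
  "\<nu> t \<equiv> noise_input (G t) (w t)"

lemma noise_L2_vec: "1 \<le> t \<Longrightarrow> square_integrable_vec M (\<nu> t)"
  unfolding square_integrable_vec_def noise_input_def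
  by (auto intro!: square_integrable_sum square_integrable_cmult noise_L2 simp: neighbors_def)

lemma noise_functional_le:
  "1 \<le> t \<Longrightarrow> expectation (\<lambda>\<omega>. (z \<bullet> \<nu> t \<omega>)\<^sup>2)
     \<le> vu * (\<Sum>(j, i)\<in>edges (G t). (z $ i * weight (G t) i j)\<^sup>2)"
  unfolding inner_noise_input by (rule noise_upper)

lemma noise_functional_ge:
  "1 \<le> t \<Longrightarrow> vl * (\<Sum>(j, i)\<in>edges (G t). (z $ i * weight (G t) i j)\<^sup>2)
     \<le> expectation (\<lambda>\<omega>. (z \<bullet> \<nu> t \<omega>)\<^sup>2)"
  unfolding inner_noise_input by (rule noise_lower)

text \<open>
  A crude bound on the second moment of the noise vector: each of the \<open>n\<close> coordinates
  is a combination of at most \<open>n\<^sup>2\<close> edge noises with coefficients at most \<open>amax\<close>.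
\<close>

definition noise_bound :: real where
  "noise_bound = real CARD('n) * (vu * (real CARD('n \<times> 'n) * amax\<^sup>2))"

lemma norm_sq_noise_le:
  assumes t: "1 \<le> t"
  shows "integrable M (\<lambda>\<omega>. (norm (\<nu> t \<omega>))\<^sup>2)"
    and "expectation (\<lambda>\<omega>. (norm (\<nu> t \<omega>))\<^sup>2) \<le> noise_bound"
proof -
  interpret balanced_digraph "G t" amax using t by (rule graph)
  have norm_sq: "(norm (\<nu> t \<omega>))\<^sup>2 = (\<Sum>k\<in>UNIV. (\<nu> t \<omega> $ k)\<^sup>2)" for \<omega>
    unfolding power2_norm_eq_inner inner_vec_def by (simp add: power2_eq_square)
  have int: "integrable M (\<lambda>\<omega>. (\<nu> t \<omega> $ k)\<^sup>2)" for k
    using noise_L2_vec[OF t] by (intro integrable_square square_integrable_vecD)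
  then show "integrable M (\<lambda>\<omega>. (norm (\<nu> t \<omega>))\<^sup>2)" unfolding norm_sq by (rule Bochner_Integration.integrable_sum)
  have "expectation (\<lambda>\<omega>. (\<nu> t \<omega> $ k)\<^sup>2) \<le> vu * (real CARD('n \<times> 'n) * amax\<^sup>2)" for k
  proof -
    have "expectation (\<lambda>\<omega>. (\<nu> t \<omega> $ k)\<^sup>2) = expectation (\<lambda>\<omega>. (axis k 1 \<bullet> \<nu> t \<omega>)\<^sup>2)"
      by (simp add: inner_axis')
    also have "\<dots> \<le> vu * (\<Sum>(j, i)\<in>edges (G t). (axis k 1 $ i * weight (G t) i j)\<^sup>2)"
      by (rule noise_functional_le[OF t])
    also have "\<dots> \<le> vu * (\<Sum>(j, i)\<in>edges (G t). amax\<^sup>2)"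
    proof (intro mult_left_mono sum_mono, clarify)
      fix j i assume e: "(j, i) \<in> edges (G t)"
      have "(axis k 1 $ i * weight (G t) i j)\<^sup>2 \<le> (weight (G t) i j)\<^sup>2"
        by (auto simp: axis_def)
      also have "\<dots> \<le> amax\<^sup>2" using weight_ge[OF e] weight_le[OF e] by (intro power_mono) auto
      finally show "(axis k 1 $ i * weight (G t) i j)\<^sup>2 \<le> amax\<^sup>2" .
    qed (use vu_pos in auto)
    also have "\<dots> \<le> vu * (real CARD('n \<times> 'n) * amax\<^sup>2)"
      using vu_pos card_mono[OF finite subset_UNIV, of "edges (G t)"]
      by (auto intro!: mult_left_mono mult_right_mono simp: case_prod_unfold simp del: card_prod)
    finally show ?thesis .
  qed
  then have "(\<Sum>k\<in>UNIV. expectation (\<lambda>\<omega>. (\<nu> t \<omega> $ k)\<^sup>2)) \<le> noise_bound"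
    unfolding noise_bound_def by (rule sum_bounded_above)
  then show "expectation (\<lambda>\<omega>. (norm (\<nu> t \<omega>))\<^sup>2) \<le> noise_bound"
    unfolding norm_sq using int by simp
qed

lemma noise_bound_nonneg: "0 \<le> noise_bound"
  using vu_pos by (simp add: noise_bound_def)

lemma expected_V_noise_le: "1 \<le> t \<Longrightarrow> expectation (\<lambda>\<omega>. V (\<nu> t \<omega>)) \<le> noise_bound"
  by (rule order_trans[OF integral_mono norm_sq_noise_le(2)])
     (rule integrable_V noise_L2_vec norm_sq_noise_le(1) V_le_norm_sq, assumption?)+

lemma expected_average_sq_noise_le:
  assumes "1 \<le> t" shows "expectation (\<lambda>\<omega>. (average (\<nu> t \<omega>))\<^sup>2) \<le> noise_bound"
proof -
  have "(average y)\<^sup>2 \<le> (norm y)\<^sup>2" for y :: "real ^ 'n"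
  proof -
    have "1 * (average y)\<^sup>2 \<le> real CARD('n) * (average y)\<^sup>2"
      using two_nodes by (intro mult_right_mono) auto
    then show ?thesis using average_sq_le[of y] by linarith
  qed
  then have "expectation (\<lambda>\<omega>. (average (\<nu> t \<omega>))\<^sup>2) \<le> expectation (\<lambda>\<omega>. (norm (\<nu> t \<omega>))\<^sup>2)"
    using assms
    by (intro integral_mono integrable_square square_integrable_average noise_L2_vec norm_sq_noise_le)
  then show ?thesis using norm_sq_noise_le(2)[OF assms] by linarith
qed

text \<open>
  One edge suffices.  Its noise enters the deviation of its head from the average with the
  coefficient \<open>1 - 1 / n\<close> times the weight, which is at least \<open>1 / 2\<close>.
\<close>

lemma expected_V_noise_ge:
  assumes t: "1 \<le> t" and "edges (G t) \<noteq> {}"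
  shows "vl / 4 \<le> expectation (\<lambda>\<omega>. V (\<nu> t \<omega>))"
proof -
  interpret balanced_digraph "G t" amax using t by (rule graph)
  obtain j i where e: "(j, i) \<in> edges (G t)" using assms(2) by auto
  define z :: "real ^ 'n" where "z = center (axis i 1)"
  have avg: "average (axis i 1 :: real ^ 'n) = 1 / real CARD('n)"
    by (simp add: average_def axis_def)
  have "z $ i = 1 - 1 / real CARD('n)"
    by (simp add: z_def avg)
  moreover have "1 / real CARD('n) \<le> 1 / 2" using two_nodes by (intro divide_left_mono) auto
  ultimately have "1 / 2 \<le> z $ i" by linarith
  then have "1 / 2 * 1 \<le> z $ i * weight (G t) i j" using weight_ge[OF e] by (intro mult_mono) auto
  then have "(1 / 2)\<^sup>2 \<le> (z $ i * weight (G t) i j)\<^sup>2" by (intro power_mono) auto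
  also have "\<dots> \<le> (\<Sum>(j, i)\<in>edges (G t). (z $ i * weight (G t) i j)\<^sup>2)"
    using member_le_sum[OF e, of "\<lambda>(j, i). (z $ i * weight (G t) i j)\<^sup>2"] by auto
  finally have "vl * (1 / 4) \<le> vl * (\<Sum>(j, i)\<in>edges (G t). (z $ i * weight (G t) i j)\<^sup>2)"
    using vl_pos by (intro mult_left_mono) (auto simp: power2_eq_square)
  also have "\<dots> \<le> expectation (\<lambda>\<omega>. (z \<bullet> \<nu> t \<omega>)\<^sup>2)" by (rule noise_functional_ge[OF t])
  also have "\<dots> \<le> expectation (\<lambda>\<omega>. V (\<nu> t \<omega>))"
  proof -
    have eq: "z \<bullet> \<nu> t \<omega> = center (\<nu> t \<omega>) $ i" for \<omega>
      unfolding z_def center_self_adjoint by (simp add: inner_axis')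
    show ?thesis unfolding eq
    proof (rule integral_mono)
      show "integrable M (\<lambda>\<omega>. (center (\<nu> t \<omega>) $ i)\<^sup>2)"
        unfolding center_nth
        by (intro integrable_square square_integrable_diff square_integrable_average
            square_integrable_vecD noise_L2_vec t)
    qed (auto intro: integrable_V noise_L2_vec t sq_le_V simp del: center_nth)
  qed
  finally show ?thesis by simp
qed

context
  fixes a :: "nat \<Rightarrow> real" and x1 :: "real ^ 'n"
begin

abbreviation trajectory :: "nat \<Rightarrow> 'a \<Rightarrow> real ^ 'n" ("X") where
  "X \<equiv> state G w a x1"

lemma state_one [simp]: "X (Suc 0) \<omega> = x1"
  by (simp add: state.simps)

lemma state_step:
  "1 \<le> t \<Longrightarrow> X (Suc t) \<omega> = (X t \<omega> + a t *\<^sub>R coupling (G t) (X t \<omega>)) + a t *\<^sub>R \<nu> t \<omega>"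
  by (simp add: state.simps vec_eq_iff coupling_def noise_input_def sum.distrib distrib_left)

lemma state_L2: "1 \<le> t \<Longrightarrow> square_integrable_vec M (X t)"
proof (induction t rule: dec_induct)
  case base
  show ?case by (simp add: square_integrable_vec_def square_integrable_const)
next
  case (step t)
  show ?case unfolding state_step[OF step(1)]
    by (intro square_integrable_vec_add square_integrable_vec_scaleR square_integrable_vec_coupling
        step noise_L2_vec)
qed

text \<open>
  The state at time \<open>t\<close> is an affine function of the noise before time \<open>t\<close>; the zero mean of
  \<open>u\<close> takes care of the constant term.
\<close>

lemma state_uncorrelated:
  assumes u: "square_integrable M u" "expectation u = 0"
    and past: "\<And>s j i. 1 \<le> s \<Longrightarrow> s < t \<Longrightarrow> (j, i) \<in> edges (G s) \<Longrightarrow> orthogonal_in_L2 M u (w s j i)"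
    and t: "1 \<le> t"
  shows "uncorrelated_vec M u (X t)"
  using t past
proof (induction t rule: dec_induct)
  case base
  show ?case using u by (simp add: uncorrelated_vec_def orthogonal_in_L2_def square_integrable_const)
next
  case (step t)
  have "uncorrelated_vec M u (X t)" using step by auto
  moreover have "uncorrelated_vec M u (\<nu> t)"
    by (intro uncorrelated_vec_noise_input u step) auto
  ultimately show ?case unfolding state_step[OF step(1)]
    by (intro uncorrelated_vec_add uncorrelated_vec_scaleR uncorrelated_vec_coupling u)
qed

lemma noise_uncorrelated_with_state:
  assumes r: "1 \<le> r" and t: "r \<le> t"
  shows "uncorrelated_vec M (\<lambda>\<omega>. \<nu> t \<omega> $ k) (X r)"
  unfolding uncorrelated_vec_def
proof
  fix i
  have t1: "1 \<le> t" using r t by simp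
  have "orthogonal_in_L2 M (w t j' i') (\<lambda>\<omega>. X r \<omega> $ i)" if e: "(j', i') \<in> edges (G t)" for j' i'
  proof (rule uncorrelated_vecD[OF state_uncorrelated])
    show "square_integrable M (w t j' i')" by (rule noise_L2[OF t1 e])
    show "expectation (w t j' i') = 0" by (rule noise_mean[OF t1 e])
    show "orthogonal_in_L2 M (w t j' i') (w s j'' i'')"
      if "1 \<le> s" "s < r" "(j'', i'') \<in> edges (G s)" for s j'' i''
      unfolding orthogonal_in_L2_def
      using that t noise_L2[OF t1 e] noise_L2[OF that(1,3)] noise_uncorrelated[OF t1 that(1) _ e that(3)]
      by auto
  qed (rule r)
  then have "uncorrelated_vec M (\<lambda>\<omega>. X r \<omega> $ i) (\<nu> t)"
    by (intro uncorrelated_vec_noise_input square_integrable_vecD state_L2 r)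
       (simp add: orthogonal_in_L2_commute)
  then show "orthogonal_in_L2 M (\<lambda>\<omega>. \<nu> t \<omega> $ k) (\<lambda>\<omega>. X r \<omega> $ i)"
    by (simp add: uncorrelated_vec_def orthogonal_in_L2_commute)
qed

text \<open>
  The cross term pairs the noise vector with a linear image of the state and vanishes.
\<close>

lemma expected_V_step:
  assumes t: "1 \<le> t"
  shows "expected_V M X (Suc t)
    = expectation (\<lambda>\<omega>. V (X t \<omega> + a t *\<^sub>R coupling (G t) (X t \<omega>)))
      + (a t)\<^sup>2 * expectation (\<lambda>\<omega>. V (\<nu> t \<omega>))"
proof -
  let ?Y = "\<lambda>\<omega>. X t \<omega> + a t *\<^sub>R coupling (G t) (X t \<omega>)"
  have Y: "square_integrable_vec M ?Y"
    by (intro square_integrable_vec_add square_integrable_vec_scaleR square_integrable_vec_coupling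
        state_L2 t)
  have noise_k: "square_integrable M (\<lambda>\<omega>. \<nu> t \<omega> $ k)" for k
    by (intro square_integrable_vecD noise_L2_vec t)
  have "uncorrelated_vec M (\<lambda>\<omega>. \<nu> t \<omega> $ k) ?Y" for k
    by (intro uncorrelated_vec_add uncorrelated_vec_scaleR uncorrelated_vec_coupling noise_k
        noise_uncorrelated_with_state t order_refl)
  then have orth: "orthogonal_in_L2 M (\<lambda>\<omega>. \<nu> t \<omega> $ k) (\<lambda>\<omega>. center (?Y \<omega>) $ k)" for k
    unfolding center_nth by (intro orthogonal_in_L2_diff orthogonal_average noise_k uncorrelated_vecD)
  have int: "integrable M (\<lambda>\<omega>. center (?Y \<omega>) $ k * \<nu> t \<omega> $ k)" for k
    using orth[of k] unfolding orthogonal_in_L2_def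
    by (intro integrable_mult_square_integrable) auto
  have "expectation (\<lambda>\<omega>. center (?Y \<omega>) \<bullet> \<nu> t \<omega>)
      = (\<Sum>k\<in>UNIV. expectation (\<lambda>\<omega>. center (?Y \<omega>) $ k * \<nu> t \<omega> $ k))"
    unfolding inner_vec_def inner_real_def using int by (rule Bochner_Integration.integral_sum)
  also have "\<dots> = 0"
    using orth by (intro sum.neutral) (simp add: orthogonal_in_L2_def mult.commute del: center_nth)
  finally have cross: "expectation (\<lambda>\<omega>. center (?Y \<omega>) \<bullet> \<nu> t \<omega>) = 0" .
  have int': "integrable M (\<lambda>\<omega>. center (?Y \<omega>) \<bullet> \<nu> t \<omega>)"
    unfolding inner_vec_def inner_real_def using int by (rule Bochner_Integration.integrable_sum)
  have "expected_V M X (Suc t)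
      = expectation (\<lambda>\<omega>. V (?Y \<omega>) + (a t)\<^sup>2 * V (\<nu> t \<omega>) + 2 * a t * (center (?Y \<omega>) \<bullet> \<nu> t \<omega>))"
    unfolding expected_V_def state_step[OF t] V_add[of "?Y _" "a t *\<^sub>R \<nu> t _"] V_scaleR by (simp add: mult.assoc)
  also have "\<dots> = expectation (\<lambda>\<omega>. V (?Y \<omega>)) + (a t)\<^sup>2 * expectation (\<lambda>\<omega>. V (\<nu> t \<omega>))"
    using integrable_V[OF Y] integrable_V[OF noise_L2_vec[OF t]] int' cross by simp
  finally show ?thesis .
qed

end

lemma amax_ge1: "1 \<le> amax"
proof -
  interpret balanced_digraph "G 1" amax using graph by simp
  show ?thesis by (rule amax_ge)
qed

text \<open>
  Bounds the squared operator norm of the coupling with respect to the square root of \<open>V\<close>.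
\<close>

definition coupling_bound :: real where
  "coupling_bound = (real CARD('n) - 1) * amax * (4 * real CARD('n) * amax)"

lemma coupling_bound_pos: "0 < coupling_bound"
  using two_nodes amax_ge1 unfolding coupling_bound_def by (intro mult_pos_pos) auto

lemma V_coupling_le': "1 \<le> t \<Longrightarrow> V (coupling (G t) x) \<le> coupling_bound * V x"
  unfolding coupling_bound_def
  by (rule weighted_digraph.V_coupling_le) (rule balanced_digraph.axioms(1)[OF graph])

section \<open>No gain sequence beats the rate 1/t\<close>

text \<open>
  The amount by which \<open>1 / v\<close> can grow in one step.  It is the quotient of the strength of
  the coupling by the lower bound \<open>vl / 4\<close> on the noise injected by a nonempty graph.
\<close>

definition max_inverse_growth :: real where
  "max_inverse_growth = coupling_bound / (vl / 4)"

lemma max_inverse_growth_pos: "0 < max_inverse_growth"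
  using coupling_bound_pos vl_pos by (simp add: max_inverse_growth_def)

lemma expected_V_nonneg: "0 \<le> expected_V M (state G w a x1) t"
  unfolding expected_V_def by (intro integral_nonneg_AE) (simp add: V_nonneg)

text \<open>
  Dividing by \<open>v t * v (Suc t)\<close> gives \<open>1 / v (Suc t) \<le> 1 / v t + max_inverse_growth\<close>, with a
  bound independent of the gain.  Undoing the coupling step costs, by Young's inequality with parameter \<open>\<theta>\<close>, the
  term \<open>(a t)\<^sup>2 * coupling_bound * v t / \<theta>\<close>.  The choice of \<open>\<theta>\<close> turns it into
  \<open>(a t)\<^sup>2 * (vl / 4)\<close>, which the injected noise pays for.
\<close>

lemma expected_V_step_ge:
  fixes a x1
  defines "v \<equiv> expected_V M (state G w a x1)"
  assumes t: "1 \<le> t" and pos: "0 < v t"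
  shows "v t \<le> (1 + max_inverse_growth * v t) * v (Suc t)"
proof (cases "edges (G t) = {}")
  case True
  then have "coupling (G t) x = 0" for x
    by (simp add: coupling_def neighbors_def vec_eq_iff)
  then have "v t \<le> v (Suc t)"
    unfolding v_def expected_V_step[OF t] by (simp add: expected_V_def V_nonneg)
  moreover have "1 * v (Suc t) \<le> (1 + max_inverse_growth * v t) * v (Suc t)"
    using pos max_inverse_growth_pos by (intro mult_right_mono) (auto simp: v_def expected_V_nonneg)
  ultimately show ?thesis by linarith
next
  case False
  let ?X = "state G w a x1 t"
  let ?Y = "\<lambda>\<omega>. ?X \<omega> + a t *\<^sub>R coupling (G t) (?X \<omega>)"
  define \<theta> where "\<theta> = max_inverse_growth * v t"
  have \<theta>: "0 < \<theta>" using pos max_inverse_growth_pos by (simp add: \<theta>_def)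
  have X: "square_integrable_vec M ?X" by (rule state_L2[OF t])
  have Y: "square_integrable_vec M ?Y"
    by (intro square_integrable_vec_add square_integrable_vec_scaleR square_integrable_vec_coupling X)
  have "V (?X \<omega>) \<le> (1 + \<theta>) * (V (?Y \<omega>) + (a t)\<^sup>2 * (coupling_bound * V (?X \<omega>)) / \<theta>)" for \<omega>
  proof -
    have "V (?X \<omega>) \<le> (1 + \<theta>) * (V (?Y \<omega>) + V ((- a t) *\<^sub>R coupling (G t) (?X \<omega>)) / \<theta>)"
      using V_add_le[OF \<theta>, of "?Y \<omega>" "(- a t) *\<^sub>R coupling (G t) (?X \<omega>)"] by simp
    also have "\<dots> \<le> (1 + \<theta>) * (V (?Y \<omega>) + (a t)\<^sup>2 * (coupling_bound * V (?X \<omega>)) / \<theta>)"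
      unfolding V_scaleR using \<theta> V_coupling_le'[OF t, of "?X \<omega>"]
      by (intro mult_left_mono add_left_mono divide_right_mono) (auto intro: mult_left_mono)
    finally show ?thesis .
  qed
  then have "v t \<le> expectation (\<lambda>\<omega>. (1 + \<theta>) * (V (?Y \<omega>) + (a t)\<^sup>2 * (coupling_bound * V (?X \<omega>)) / \<theta>))"
    unfolding v_def expected_V_def using integrable_V[OF X] integrable_V[OF Y]
    by (intro integral_mono) auto
  also have "\<dots> = (1 + \<theta>) * (expectation (\<lambda>\<omega>. V (?Y \<omega>)) + (a t)\<^sup>2 * (coupling_bound * v t) / \<theta>)"
    using integrable_V[OF X] integrable_V[OF Y] by (simp add: v_def expected_V_def)
  also have "(a t)\<^sup>2 * (coupling_bound * v t) / \<theta> = (a t)\<^sup>2 * (vl / 4)"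
    using pos coupling_bound_pos vl_pos by (simp add: \<theta>_def max_inverse_growth_def)
  also have "(1 + \<theta>) * (expectation (\<lambda>\<omega>. V (?Y \<omega>)) + (a t)\<^sup>2 * (vl / 4)) \<le> (1 + \<theta>) * v (Suc t)"
    unfolding v_def expected_V_step[OF t] using \<theta> expected_V_noise_ge[OF t False]
    by (intro mult_left_mono add_left_mono) auto
  finally show ?thesis by (simp add: \<theta>_def)
qed

lemma expected_V_lower_bound:
  assumes "0 < V x1" and t: "1 \<le> t"
  shows "1 / (1 / V x1 + max_inverse_growth) * (1 / real t) \<le> expected_V M (state G w a x1) t"
proof -
  let ?v = "expected_V M (state G w a x1)"
  have "0 < ?v t \<and> 1 / ?v t \<le> 1 / V x1 + max_inverse_growth * (real t - 1)"
    using t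
  proof (induction t rule: dec_induct)
    case base
    then show ?case using assms by (simp add: expected_V_def prob_space)
  next
    case (step t)
    let ?q = "1 + max_inverse_growth * ?v t"
    have v: "0 < ?v t" and q: "0 < ?q" using step max_inverse_growth_pos by (auto intro: add_pos_pos)
    have le: "?v t / ?q \<le> ?v (Suc t)"
      using expected_V_step_ge[OF step(1) v] q by (simp add: pos_divide_le_eq mult.commute)
    moreover have pos: "0 < ?v t / ?q" using v q by simp
    ultimately have "0 < ?v (Suc t)" by linarith
    moreover have "1 / ?v (Suc t) \<le> 1 / (?v t / ?q)"
      using le pos by (intro divide_left_mono mult_pos_pos) auto
    moreover have "1 / (?v t / ?q) = 1 / ?v t + max_inverse_growth"
      using v by (simp add: add_divide_distrib)
    moreover have "1 / ?v t \<le> 1 / V x1 + max_inverse_growth * (real t - 1)" using step by simp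
    ultimately show ?case by (simp add: algebra_simps)
  qed
  then have v: "0 < ?v t" and "1 / ?v t \<le> 1 / V x1 + max_inverse_growth * (real t - 1)" by auto
  note this(2)
  also have "\<dots> \<le> 1 / V x1 * real t + max_inverse_growth * real t"
    using assms max_inverse_growth_pos mult_left_mono[of 1 "real t" "1 / V x1"]
    by (intro add_mono mult_left_mono) auto
  finally have "1 / ?v t \<le> (1 / V x1 + max_inverse_growth) * real t" by (simp add: distrib_right)
  then have "1 / ((1 / V x1 + max_inverse_growth) * real t) \<le> 1 / (1 / ?v t)"
    using v t assms max_inverse_growth_pos by (intro divide_left_mono mult_pos_pos add_pos_pos) auto
  then show ?thesis by simp
qed

section \<open>Mean-square convergence of the average\<close>

lemma expected_average: "1 \<le> t \<Longrightarrow> expectation (\<lambda>\<omega>. average (state G w a x1 t \<omega>)) = average x1"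
proof (induction t rule: dec_induct)
  case base
  show ?case by (simp add: prob_space)
next
  case (step t)
  interpret balanced_digraph "G t" amax using step(1) by (rule graph)
  have "expectation (\<lambda>\<omega>. \<nu> t \<omega> $ i) = 0" for i
    unfolding noise_input_def using step(1)
    by (simp add: noise_mean noise_L2 integrable_square_integrable neighbors_def)
  then have "expectation (\<lambda>\<omega>. average (\<nu> t \<omega>)) = 0"
    unfolding average_def using noise_L2_vec[OF step(1)]
    by (simp add: square_integrable_vecD integrable_square_integrable)
  then show ?case
    unfolding state_step[OF step(1)] average_add average_scaleR average_coupling
    using step integrable_square_integrable[OF square_integrable_average[OF noise_L2_vec[OF step(1)]]]
      integrable_square_integrable[OF square_integrable_average[OF state_L2[OF step(1)]]]
    by simp
qed

text \<open>
  The coupling preserves the average, so its increments are \<open>a s\<close> times the average of the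
  noise at time \<open>s\<close>.  They are orthogonal, and their second moments add up.
\<close>

lemma expected_average_increment_le:
  assumes "1 \<le> r" "r \<le> t"
  shows "expectation (\<lambda>\<omega>. (average (state G w a x1 t \<omega>) - average (state G w a x1 r \<omega>))\<^sup>2)
    \<le> noise_bound * (\<Sum>s\<in>{r..<t}. (a s)\<^sup>2)"
  using assms(2)
proof (induction t rule: dec_induct)
  case base
  show ?case by simp
next
  case (step t)
  let ?A = "\<lambda>t \<omega>. average (state G w a x1 t \<omega>)"
  have t: "1 \<le> t" using assms(1) step(1) by simp
  interpret balanced_digraph "G t" amax using t by (rule graph)
  have noise_avg: "square_integrable M (\<lambda>\<omega>. average (\<nu> t \<omega>))"
    by (intro square_integrable_average noise_L2_vec t)
  have "orthogonal_in_L2 M (\<lambda>\<omega>. ?A s \<omega>) (\<lambda>\<omega>. average (\<nu> t \<omega>))" if s: "1 \<le> s" "s \<le> t" for s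
  proof (rule orthogonal_average)
    show "square_integrable M (?A s)" by (intro square_integrable_average state_L2 s)
    show "uncorrelated_vec M (?A s) (\<nu> t)"
      unfolding uncorrelated_vec_def
    proof
      fix k
      have "orthogonal_in_L2 M (\<lambda>\<omega>. \<nu> t \<omega> $ k) (?A s)"
        by (intro orthogonal_average square_integrable_vecD noise_L2_vec t
            noise_uncorrelated_with_state s)
      then show "orthogonal_in_L2 M (?A s) (\<lambda>\<omega>. \<nu> t \<omega> $ k)" by (simp add: orthogonal_in_L2_commute)
    qed
  qed
  then have "orthogonal_in_L2 M (\<lambda>\<omega>. average (\<nu> t \<omega>)) (\<lambda>\<omega>. ?A t \<omega> - ?A r \<omega>)"
    using assms(1) step(1) t
    by (intro orthogonal_in_L2_diff) (auto simp: orthogonal_in_L2_commute)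
  then have orth: "orthogonal_in_L2 M (\<lambda>\<omega>. ?A t \<omega> - ?A r \<omega>) (\<lambda>\<omega>. a t * average (\<nu> t \<omega>))"
    by (intro orthogonal_in_L2_cmult) (simp add: orthogonal_in_L2_commute)
  have "expectation (\<lambda>\<omega>. (?A (Suc t) \<omega> - ?A r \<omega>)\<^sup>2)
      = expectation (\<lambda>\<omega>. ((?A t \<omega> - ?A r \<omega>) + a t * average (\<nu> t \<omega>))\<^sup>2)"
    unfolding state_step[OF t] average_add average_scaleR average_coupling
    by (simp add: algebra_simps)
  also have "\<dots> = expectation (\<lambda>\<omega>. (?A t \<omega> - ?A r \<omega>)\<^sup>2)
      + (a t)\<^sup>2 * expectation (\<lambda>\<omega>. (average (\<nu> t \<omega>))\<^sup>2)"
    using integral_sq_add_orthogonal[OF orth] by (simp add: power_mult_distrib)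
  also have "\<dots> \<le> noise_bound * (\<Sum>s\<in>{r..<t}. (a s)\<^sup>2) + (a t)\<^sup>2 * noise_bound"
    using step(3) expected_average_sq_noise_le[OF t] by (intro add_mono mult_left_mono) auto
  also have "\<dots> = noise_bound * (\<Sum>s\<in>{r..<Suc t}. (a s)\<^sup>2)"
    using step(1) by (simp add: sum.atLeastLessThan_Suc distrib_left mult.commute)
  finally show ?case .
qed

text \<open>
  The tails of the convergent series of squared gains serve as Cauchy moduli.  The mean is
  preserved because the first moment is continuous in mean square.
\<close>

lemma average_converges_in_L2:
  assumes "summable (\<lambda>s. (a s)\<^sup>2)"
  obtains xs e where "square_integrable M xs" "expectation xs = average x1" "e \<longlonglongrightarrow> 0"
    "\<And>t. 1 \<le> t \<Longrightarrow> expectation (\<lambda>\<omega>. (xs \<omega> - average (state G w a x1 t \<omega>))\<^sup>2) \<le> e t"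
proof -
  let ?A = "\<lambda>t \<omega>. average (state G w a x1 t \<omega>)"
  define e where "e t = noise_bound * ((\<Sum>s. (a s)\<^sup>2) - (\<Sum>s<t. (a s)\<^sup>2))" for t
  have "e \<longlonglongrightarrow> noise_bound * ((\<Sum>s. (a s)\<^sup>2) - (\<Sum>s. (a s)\<^sup>2))"
    unfolding e_def using summable_LIMSEQ[OF assms] by (intro tendsto_intros)
  then have e0: "e \<longlonglongrightarrow> 0" by simp
  have A: "square_integrable M (?A t)" if "1 \<le> t" for t
    by (intro square_integrable_average state_L2 that)
  have cauchy: "expectation (\<lambda>\<omega>. (?A (Suc t) \<omega> - ?A (Suc r) \<omega>)\<^sup>2) \<le> e (Suc r)" if "r \<le> t" for r t
  proof -
    have "expectation (\<lambda>\<omega>. (?A (Suc t) \<omega> - ?A (Suc r) \<omega>)\<^sup>2)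
        \<le> noise_bound * (\<Sum>s\<in>{Suc r..<Suc t}. (a s)\<^sup>2)"
      using that by (intro expected_average_increment_le) auto
    also have "(\<Sum>s\<in>{Suc r..<Suc t}. (a s)\<^sup>2) = (\<Sum>s<Suc t. (a s)\<^sup>2) - (\<Sum>s<Suc r. (a s)\<^sup>2)"
      using that sum_diff_nat_ivl[of 0 "Suc r" "Suc t" "\<lambda>s. (a s)\<^sup>2"] by (simp only: atLeast0LessThan)
    also have "noise_bound * \<dots> \<le> e (Suc r)"
      unfolding e_def using noise_bound_nonneg assms
      by (intro mult_left_mono diff_right_mono sum_le_suminf) auto
    finally show ?thesis .
  qed
  obtain xs where xs: "square_integrable M xs"
    and lim: "\<And>t. expectation (\<lambda>\<omega>. (xs \<omega> - ?A (Suc t) \<omega>)\<^sup>2) \<le> e (Suc t)"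
    by (rule L2_Cauchy_limit[of "\<lambda>t. ?A (Suc t)" "\<lambda>t. e (Suc t)"])
       (use A cauchy LIMSEQ_Suc[OF e0] in auto)
  have lim': "expectation (\<lambda>\<omega>. (xs \<omega> - ?A t \<omega>)\<^sup>2) \<le> e t" if "1 \<le> t" for t
    using lim[of "t - 1"] that by simp
  have "(expectation xs - average x1)\<^sup>2 \<le> e t" if t: "1 \<le> t" for t
  proof -
    have "(expectation xs - average x1)\<^sup>2 = (expectation (\<lambda>\<omega>. xs \<omega> - ?A t \<omega>))\<^sup>2"
      using xs A[OF t] expected_average[OF t] by (simp add: integrable_square_integrable)
    also have "\<dots> \<le> expectation (\<lambda>\<omega>. (xs \<omega> - ?A t \<omega>)\<^sup>2)"
      by (intro expectation_sq_le square_integrable_diff xs A t)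
    also have "\<dots> \<le> e t" by (rule lim'[OF t])
    finally show ?thesis .
  qed
  then have "(expectation xs - average x1)\<^sup>2 \<le> 0"
    using e0 by (intro LIMSEQ_le_const[of e]) auto
  then have "expectation xs = average x1" by simp
  with xs e0 lim' show thesis by (intro that[of xs e])
qed

lemma unbiased_consensus_of_V_tendsto_0:
  assumes "summable (\<lambda>s. (a s)\<^sup>2)" and "expected_V M (state G w a x1) \<longlonglongrightarrow> 0"
  shows "unbiased_ms_average_consensus M x1 (state G w a x1)"
proof -
  let ?X = "state G w a x1"
  obtain xs e where xs: "square_integrable M xs" "expectation xs = average x1" and e: "e \<longlonglongrightarrow> 0"
    and lim: "\<And>t. 1 \<le> t \<Longrightarrow> expectation (\<lambda>\<omega>. (xs \<omega> - average (?X t \<omega>))\<^sup>2) \<le> e t"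
    using average_converges_in_L2[OF assms(1)] by blast
  have le: "(\<integral>\<^sup>+\<omega>. ennreal ((norm (?X t \<omega> - xs \<omega> *\<^sub>R vec 1))\<^sup>2) \<partial>M)
      \<le> ennreal (expected_V M ?X t + real CARD('n) * e t)" if t: "1 \<le> t" for t
  proof -
    have int: "integrable M (\<lambda>\<omega>. (average (?X t \<omega>) - xs \<omega>)\<^sup>2)"
      by (intro integrable_square square_integrable_diff square_integrable_average state_L2 t xs)
    have intV: "integrable M (\<lambda>\<omega>. V (?X t \<omega>))" by (intro integrable_V state_L2 t)
    have "(\<integral>\<^sup>+\<omega>. ennreal ((norm (?X t \<omega> - xs \<omega> *\<^sub>R vec 1))\<^sup>2) \<partial>M)
        = ennreal (expectation (\<lambda>\<omega>. V (?X t \<omega>) + real CARD('n) * (average (?X t \<omega>) - xs \<omega>)\<^sup>2))"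
      unfolding norm_sq_diff_consensus using int intV
      by (intro nn_integral_eq_integral) (auto simp: V_nonneg)
    also have "expectation (\<lambda>\<omega>. V (?X t \<omega>) + real CARD('n) * (average (?X t \<omega>) - xs \<omega>)\<^sup>2)
        = expected_V M ?X t + real CARD('n) * expectation (\<lambda>\<omega>. (xs \<omega> - average (?X t \<omega>))\<^sup>2)"
      using int intV unfolding power2_commute[of "xs _"] by (simp add: expected_V_def)
    also have "ennreal \<dots> \<le> ennreal (expected_V M ?X t + real CARD('n) * e t)"
      using lim[OF t] by (intro ennreal_leI add_left_mono mult_left_mono) auto
    finally show ?thesis .
  qed
  have "(\<lambda>t. ennreal (expected_V M ?X t + real CARD('n) * e t)) \<longlonglongrightarrow> ennreal (0 + real CARD('n) * 0)"
    using assms(2) e by (intro tendsto_intros)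
  then have bound: "(\<lambda>t. ennreal (expected_V M ?X t + real CARD('n) * e t)) \<longlonglongrightarrow> 0" by simp
  have "(\<lambda>t. \<integral>\<^sup>+\<omega>. ennreal ((norm (?X t \<omega> - xs \<omega> *\<^sub>R vec 1))\<^sup>2) \<partial>M) \<longlonglongrightarrow> 0"
  proof (rule tendsto_sandwich[OF _ _ tendsto_const bound])
    show "\<forall>\<^sub>F t in sequentially. (\<integral>\<^sup>+\<omega>. ennreal ((norm (?X t \<omega> - xs \<omega> *\<^sub>R vec 1))\<^sup>2) \<partial>M)
        \<le> ennreal (expected_V M ?X t + real CARD('n) * e t)"
      using eventually_ge_at_top[of 1] by eventually_elim (rule le)
  qed simp
  moreover have "integrable M (\<lambda>\<omega>. (xs \<omega> - expectation xs)\<^sup>2)"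
    by (intro integrable_square square_integrable_diff xs square_integrable_const)
  ultimately show ?thesis
    unfolding unbiased_ms_average_consensus_def
    using xs integrable_square_integrable[OF xs(1)] by blast
qed

end

section \<open>The rate 1/t is attained\<close>

text \<open>
  Comparison with \<open>K / u\<close> for \<open>u = t + \<tau>\<close>.  From \<open>u\<close> to \<open>u + N\<close> this bound decreases by at
  most \<open>K * N / u\<^sup>2\<close>, whereas the contraction with coefficient \<open>3 / 2\<close> removes
  \<open>(3 / 2) * K * N / u\<^sup>2\<close>.  The surplus \<open>K * N / (2 * u\<^sup>2)\<close> absorbs the perturbation as soon as
  \<open>2 * R / N \<le> K\<close>.
\<close>

lemma rate_of_window_recursion:
  fixes v :: "nat \<Rightarrow> real" and \<tau> R :: real and N T :: nat
  assumes N: "1 \<le> N" and R: "0 \<le> R" and T: "3 * real N \<le> real T + \<tau>"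
    and rec: "\<And>t. T \<le> t \<Longrightarrow> v (t + N) \<le> (1 - 3 / 2 * real N / (real t + \<tau>)) * v t + R / (real t + \<tau>)\<^sup>2"
  shows "\<exists>K>0. \<forall>t\<ge>T. v t \<le> K / (real t + \<tau>)"
proof -
  \<comment> \<open>The sum takes care of the first window, where the recursion gives nothing.\<close>
  define K where "K = 1 + 2 * R / N + (\<Sum>t\<in>{T..<T + N}. \<bar>v t * (real t + \<tau>)\<bar>)"
  have "0 \<le> (\<Sum>t\<in>{T..<T + N}. \<bar>v t * (real t + \<tau>)\<bar>)" "0 \<le> 2 * R / N"
    using R by (auto intro: sum_nonneg)
  then have K: "0 < K" "2 * R / N \<le> K" unfolding K_def by linarith+
  have "v t \<le> K / (real t + \<tau>)" if "T \<le> t" for t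
    using that
  proof (induction t rule: less_induct)
    case (less t)
    have u_pos: "0 < real t + \<tau>" using T N less.prems by linarith
    show ?case
    proof (cases "t < T + N")
      case True
      then have "\<bar>v t * (real t + \<tau>)\<bar> \<le> (\<Sum>t\<in>{T..<T + N}. \<bar>v t * (real t + \<tau>)\<bar>)"
        using less.prems by (intro member_le_sum) auto
      also have "\<dots> \<le> K" using R by (simp add: K_def)
      finally show ?thesis using u_pos by (simp add: pos_le_divide_eq)
    next
      case False
      define s where "s = t - N"
      have s: "T \<le> s" "s < t" "t = s + N" using False N by (auto simp: s_def)
      define u where "u = real s + \<tau>"
      have u: "3 * real N \<le> u" "0 < u" using T s(1) N unfolding u_def by linarith+
      have "v t \<le> (1 - 3 / 2 * real N / u) * v s + R / u\<^sup>2"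
        using rec[OF s(1)] s(3) by (simp add: u_def)
      also have "\<dots> \<le> (1 - 3 / 2 * real N / u) * (K / u) + R / u\<^sup>2"
      proof -
        have "0 \<le> 1 - 3 / 2 * real N / u" using u by (simp add: field_simps)
        then show ?thesis
          using less.IH[OF s(2,1)] unfolding u_def by (intro add_right_mono mult_left_mono)
      qed
      also have "\<dots> \<le> K / u - K * N / u\<^sup>2"
      proof -
        have "R \<le> K * N / 2" using K(2) N by (simp add: field_simps)
        then have "R / u\<^sup>2 \<le> (K * N / 2) / u\<^sup>2" by (rule divide_right_mono) simp
        moreover have "(1 - 3 / 2 * real N / u) * (K / u) = K / u - 3 / 2 * (K * N / u\<^sup>2)"
          using u(2) by (simp add: field_simps power2_eq_square)
        ultimately show ?thesis by (simp add: field_simps)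
      qed
      also have "\<dots> \<le> K / (u + N)"
      proof -
        have "K / u - K / (u + N) = K * N / (u * (u + N))"
          using u N by (simp add: field_simps)
        also have "\<dots> \<le> K * N / u\<^sup>2"
          using u K(1) N unfolding power2_eq_square by (intro divide_left_mono mult_left_mono) auto
        finally show ?thesis by simp
      qed
      finally show ?thesis using s(3) by (simp add: u_def add_ac)
    qed
  qed
  with K(1) show ?thesis by blast
qed

context noisy_network
begin

text \<open>
  The smallness of the gain leaves at least half of the first-order dissipation; weights are
  at least 1, so the disagreement may be replaced by the edge energy.
\<close>

lemma expected_V_step_le:
  assumes t: "1 \<le> t" and a: "0 \<le> a t" "a t * ((real CARD('n) - 1) * amax) \<le> 1 / 2"
  shows "expected_V M (state G w a x1) (Suc t) \<le> expected_V M (state G w a x1) t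
     - a t / 2 * expectation (\<lambda>\<omega>. edge_energy (edges (G t)) (state G w a x1 t \<omega>))
     + (a t)\<^sup>2 * noise_bound"
proof -
  interpret balanced_digraph "G t" amax using t by (rule graph)
  let ?X = "state G w a x1 t"
  let ?E = "\<lambda>x. edge_energy (edges (G t)) x"
  have X: "square_integrable_vec M ?X" by (rule state_L2[OF t])
  have step: "V (x + a t *\<^sub>R coupling (G t) x) \<le> V x - a t / 2 * ?E x" for x
  proof -
    have "a t * (1 / 2) * ?E x \<le> a t * (1 - a t * ((real CARD('n) - 1) * amax)) * disagreement (G t) x"
      using a edge_energy_nonneg edge_energy_le_disagreement by (intro mult_mono) auto
    then show ?thesis using V_step_le[of x "a t"] by simp
  qed
  have "expectation (\<lambda>\<omega>. V (?X \<omega> + a t *\<^sub>R coupling (G t) (?X \<omega>)))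
      \<le> expectation (\<lambda>\<omega>. V (?X \<omega>) - a t / 2 * ?E (?X \<omega>))"
  proof (rule integral_mono)
    show "integrable M (\<lambda>\<omega>. V (?X \<omega> + a t *\<^sub>R coupling (G t) (?X \<omega>)))"
      by (intro integrable_V square_integrable_vec_add square_integrable_vec_scaleR
          square_integrable_vec_coupling X)
  qed (use integrable_V[OF X] integrable_edge_energy[OF X] step in auto)
  also have "\<dots> = expected_V M (state G w a x1) t - a t / 2 * expectation (\<lambda>\<omega>. ?E (?X \<omega>))"
    using integrable_V[OF X] integrable_edge_energy[OF X] by (simp add: expected_V_def)
  finally show ?thesis
    unfolding expected_V_step[OF t] using expected_V_noise_le[OF t]
    by (intro add_mono mult_left_mono) auto
qed

text \<open>
  The state moves in one step by the gain times a vector of bounded second moment, once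
  \<open>v\<close> is known to be bounded.
\<close>

lemma expected_V_increment_le:
  assumes u: "1 \<le> u" and K: "expected_V M (state G w a x1) u \<le> K"
  shows "expectation (\<lambda>\<omega>. V (state G w a x1 (Suc u) \<omega> - state G w a x1 u \<omega>))
    \<le> (a u)\<^sup>2 * (2 * (coupling_bound * K + noise_bound))"
proof -
  let ?X = "state G w a x1 u"
  have X: "square_integrable_vec M ?X" by (rule state_L2[OF u])
  have D: "square_integrable_vec M (\<lambda>\<omega>. coupling (G u) (?X \<omega>))"
    by (rule square_integrable_vec_coupling[OF X])
  have N: "square_integrable_vec M (\<nu> u)" by (rule noise_L2_vec[OF u])
  have "state G w a x1 (Suc u) \<omega> - ?X \<omega> = a u *\<^sub>R (coupling (G u) (?X \<omega>) + \<nu> u \<omega>)" for \<omega>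
    unfolding state_step[OF u] by (simp add: scaleR_add_right)
  then have "expectation (\<lambda>\<omega>. V (state G w a x1 (Suc u) \<omega> - ?X \<omega>))
      = (a u)\<^sup>2 * expectation (\<lambda>\<omega>. V (coupling (G u) (?X \<omega>) + \<nu> u \<omega>))"
    by (simp add: V_scaleR)
  also have "\<dots> \<le> (a u)\<^sup>2 * expectation (\<lambda>\<omega>. 2 * (coupling_bound * V (?X \<omega>) + V (\<nu> u \<omega>)))"
  proof (intro mult_left_mono integral_mono)
    show "integrable M (\<lambda>\<omega>. V (coupling (G u) (?X \<omega>) + \<nu> u \<omega>))"
      by (intro integrable_V square_integrable_vec_add D N)
    show "integrable M (\<lambda>\<omega>. 2 * (coupling_bound * V (?X \<omega>) + V (\<nu> u \<omega>)))"
      using integrable_V[OF X] integrable_V[OF N] by simp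
    show "V (coupling (G u) (?X \<omega>) + \<nu> u \<omega>) \<le> 2 * (coupling_bound * V (?X \<omega>) + V (\<nu> u \<omega>))" for \<omega>
      using V_add_le[of 1 "coupling (G u) (?X \<omega>)" "\<nu> u \<omega>"] V_coupling_le'[OF u, of "?X \<omega>"] by simp
  qed simp
  also have "\<dots> = (a u)\<^sup>2 * (2 * (coupling_bound * expected_V M (state G w a x1) u
      + expectation (\<lambda>\<omega>. V (\<nu> u \<omega>))))"
    using integrable_V[OF X] integrable_V[OF N] by (simp add: expected_V_def)
  also have "\<dots> \<le> (a u)\<^sup>2 * (2 * (coupling_bound * K + noise_bound))"
    using K coupling_bound_pos expected_V_noise_le[OF u] by (intro mult_left_mono add_mono) auto
  finally show ?thesis .
qed

context
  fixes a :: "nat \<Rightarrow> real"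
  assumes gain_nonneg: "\<And>t. 1 \<le> t \<Longrightarrow> 0 \<le> a t"
    and gain_small: "\<And>t. 1 \<le> t \<Longrightarrow> a t * ((real CARD('n) - 1) * amax) \<le> 1 / 2"
    and gain_antimono: "\<And>s t. 1 \<le> s \<Longrightarrow> s \<le> t \<Longrightarrow> a t \<le> a s"
begin

lemma expected_V_bounded:
  assumes "summable (\<lambda>s. (a s)\<^sup>2)" and "1 \<le> t"
  shows "expected_V M (state G w a x1) t \<le> V x1 + noise_bound * (\<Sum>s. (a s)\<^sup>2)"
proof -
  have "expected_V M (state G w a x1) t \<le> V x1 + noise_bound * (\<Sum>s<t. (a s)\<^sup>2)"
    using assms(2)
  proof (induction t rule: dec_induct)
    case base
    show ?case using noise_bound_nonneg by (simp add: expected_V_def prob_space)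
  next
    case (step t)
    have "0 \<le> a t / 2 * expectation (\<lambda>\<omega>. edge_energy (edges (G t)) (state G w a x1 t \<omega>))"
      using gain_nonneg[OF step(1)]
      by (intro mult_nonneg_nonneg integral_nonneg_AE) (auto simp: edge_energy_nonneg)
    with step expected_V_step_le[of t a x1, OF step(1) gain_nonneg[OF step(1)] gain_small[OF step(1)]]
    show ?case by (simp add: algebra_simps)
  qed
  also have "\<dots> \<le> V x1 + noise_bound * (\<Sum>s. (a s)\<^sup>2)"
    using assms(1) noise_bound_nonneg by (intro add_left_mono mult_left_mono sum_le_suminf) auto
  finally show ?thesis .
qed

text \<open>
  The constant grows exponentially in \<open>d\<close>, which is harmless because \<open>d\<close> is going to be at most
  the fixed length of a window; what matters is the order \<open>(a t)\<^sup>2\<close>.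
\<close>

lemma expected_V_displacement_le:
  assumes K: "\<And>t. 1 \<le> t \<Longrightarrow> expected_V M (state G w a x1) t \<le> K" and t: "1 \<le> t"
  shows "expectation (\<lambda>\<omega>. V (state G w a x1 (t + d) \<omega> - state G w a x1 t \<omega>))
    \<le> 4 ^ d * ((a t)\<^sup>2 * (2 * (coupling_bound * K + noise_bound)))"
proof -
  define Z where "Z = 2 * (coupling_bound * K + noise_bound)"
  have "0 \<le> K" using order_trans[OF expected_V_nonneg K[of 1]] by simp
  then have Z: "0 \<le> Z" using coupling_bound_pos noise_bound_nonneg by (simp add: Z_def)
  have "expectation (\<lambda>\<omega>. V (state G w a x1 (t + d) \<omega> - state G w a x1 t \<omega>))
      \<le> 4 ^ d * ((a t)\<^sup>2 * Z)"
  proof (induction d)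
    case 0
    show ?case using Z by (simp add: V_def average_def)
  next
    case (Suc d)
    let ?X = "state G w a x1"
    have td: "1 \<le> t + d" using t by simp
    have D: "square_integrable_vec M (\<lambda>\<omega>. ?X (Suc (t + d)) \<omega> - ?X (t + d) \<omega>)"
      and S: "square_integrable_vec M (\<lambda>\<omega>. ?X (t + d) \<omega> - ?X t \<omega>)"
      and DS: "square_integrable_vec M (\<lambda>\<omega>. ?X (Suc (t + d)) \<omega> - ?X t \<omega>)"
      using t by (auto intro!: square_integrable_vec_diff state_L2)
    have "expectation (\<lambda>\<omega>. V (?X (Suc (t + d)) \<omega> - ?X t \<omega>))
        \<le> expectation (\<lambda>\<omega>. 2 * (V (?X (Suc (t + d)) \<omega> - ?X (t + d) \<omega>) + V (?X (t + d) \<omega> - ?X t \<omega>)))"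
    proof (rule integral_mono)
      show "V (?X (Suc (t + d)) \<omega> - ?X t \<omega>)
          \<le> 2 * (V (?X (Suc (t + d)) \<omega> - ?X (t + d) \<omega>) + V (?X (t + d) \<omega> - ?X t \<omega>))" for \<omega>
        using V_add_le[of 1 "?X (Suc (t + d)) \<omega> - ?X (t + d) \<omega>" "?X (t + d) \<omega> - ?X t \<omega>"]
        by simp
    qed (use integrable_V[OF D] integrable_V[OF S] integrable_V[OF DS] in auto)
    also have "\<dots> = 2 * (expectation (\<lambda>\<omega>. V (?X (Suc (t + d)) \<omega> - ?X (t + d) \<omega>))
        + expectation (\<lambda>\<omega>. V (?X (t + d) \<omega> - ?X t \<omega>)))"
      using integrable_V[OF D] integrable_V[OF S] by simp
    also have "\<dots> \<le> 2 * ((a t)\<^sup>2 * Z + 4 ^ d * ((a t)\<^sup>2 * Z))"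
    proof (intro mult_left_mono add_mono)
      have "(a (t + d))\<^sup>2 * Z \<le> (a t)\<^sup>2 * Z"
        using Z gain_nonneg[OF td] gain_antimono[of t "t + d"] t by (intro mult_right_mono power_mono) auto
      with expected_V_increment_le[OF td K[OF td], folded Z_def]
      show "expectation (\<lambda>\<omega>. V (?X (Suc (t + d)) \<omega> - ?X (t + d) \<omega>)) \<le> (a t)\<^sup>2 * Z"
        by simp
    qed (use Suc in auto)
    also have "\<dots> \<le> 4 ^ Suc d * ((a t)\<^sup>2 * Z)"
    proof -
      have "1 * ((a t)\<^sup>2 * Z) \<le> 4 ^ d * ((a t)\<^sup>2 * Z)" using Z by (intro mult_right_mono) auto
      then show ?thesis by (simp add: mult_ac)
    qed
    finally show ?case by simp
  qed
  then show ?thesis by (simp only: Z_def)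
qed

text \<open>
  Each step of the window dissipates a multiple of the energy of its graph at the current
  state.  Replacing the current state by the initial state of the window costs half of the
  energy and an error controlled by the displacement.  The energies at the initial state
  then add up to at least the energy of the strongly connected union.
\<close>

lemma expected_V_window_contraction:
  fixes N :: nat
  assumes conn: "strongly_connected_edges (\<Union>s\<in>{t..<t + N}. edges (G s))"
    and K: "\<And>t. 1 \<le> t \<Longrightarrow> expected_V M (state G w a x1) t \<le> K" and t: "1 \<le> t"
  defines "Z \<equiv> 2 * (coupling_bound * K + noise_bound)"
  shows "expected_V M (state G w a x1) (t + N)
    \<le> (1 - a (t + N) / (4 * (real CARD('n) - 1)\<^sup>2)) * expected_V M (state G w a x1) t
      + N * (noise_bound + a 1 * (2 * real CARD('n) * 4 ^ N * Z)) * (a t)\<^sup>2"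
proof -
  let ?X = "state G w a x1"
  let ?v = "expected_V M ?X"
  let ?m = "real CARD('n) - 1"
  let ?E = "\<lambda>s x. edge_energy (edges (G s)) x"
  let ?c = "2 * real CARD('n) * 4 ^ N * Z"
  have "0 \<le> K" using order_trans[OF expected_V_nonneg K[of 1]] by simp
  then have Z: "0 \<le> Z" using coupling_bound_pos noise_bound_nonneg by (simp add: Z_def)
  have m: "0 < ?m" using two_nodes by simp
  have X: "square_integrable_vec M (?X s)" if "t \<le> s" for s
    using that t by (intro state_L2) auto
  have nonneg: "0 \<le> expectation (\<lambda>\<omega>. edge_energy E (?X t \<omega>))" for E
    by (intro integral_nonneg_AE) (auto simp: edge_energy_nonneg)
  \<comment> \<open>The displacement error is of order \<open>a s * (a t)\<^sup>2\<close>; bounding \<open>a s\<close> by \<open>a 1\<close> makes it of the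
  same order as the noise.\<close>
  have dissip: "a (t + N) / 4 * expectation (\<lambda>\<omega>. ?E s (?X t \<omega>)) - a 1 * ?c * (a t)\<^sup>2
      \<le> a s / 2 * expectation (\<lambda>\<omega>. ?E s (?X s \<omega>))" if s: "t \<le> s" "s < t + N" for s
  proof -
    interpret balanced_digraph "G s" amax using t s by (intro graph) auto
    have s1: "1 \<le> s" using t s by simp
    have XX: "square_integrable_vec M (\<lambda>\<omega>. ?X s \<omega> - ?X t \<omega>)"
      using s by (intro square_integrable_vec_diff X) auto
    let ?d = "4 ^ N * ((a t)\<^sup>2 * Z)"
    have "expectation (\<lambda>\<omega>. V (?X s \<omega> - ?X t \<omega>)) \<le> 4 ^ (s - t) * ((a t)\<^sup>2 * Z)"
      using expected_V_displacement_le[OF K t, of "s - t"] s unfolding Z_def by simp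
    also have "\<dots> \<le> ?d" using s Z by (intro mult_right_mono power_increasing) auto
    finally have disp: "expectation (\<lambda>\<omega>. V (?X s \<omega> - ?X t \<omega>)) \<le> ?d" .
    have "expectation (\<lambda>\<omega>. ?E s (?X t \<omega>) / 2 - 4 * real CARD('n) * V (?X s \<omega> - ?X t \<omega>))
        \<le> expectation (\<lambda>\<omega>. ?E s (?X s \<omega>))"
    proof (rule integral_mono)
      show "?E s (?X t \<omega>) / 2 - 4 * real CARD('n) * V (?X s \<omega> - ?X t \<omega>) \<le> ?E s (?X s \<omega>)" for \<omega>
        using edge_energy_perturb[of "edges (G s)" "?X t \<omega>" "?X s \<omega>"]
          edge_energy_le_V[of "edges (G s)" "?X s \<omega> - ?X t \<omega>"] by linarith
    qed (use integrable_edge_energy[OF X] integrable_V[OF XX] s in auto)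
    then have "expectation (\<lambda>\<omega>. ?E s (?X t \<omega>)) / 2 - 4 * real CARD('n) * expectation (\<lambda>\<omega>. V (?X s \<omega> - ?X t \<omega>))
        \<le> expectation (\<lambda>\<omega>. ?E s (?X s \<omega>))"
      using integrable_edge_energy[OF X] integrable_V[OF XX] by simp
    moreover have "4 * real CARD('n) * expectation (\<lambda>\<omega>. V (?X s \<omega> - ?X t \<omega>)) \<le> 4 * real CARD('n) * ?d"
      by (intro mult_left_mono disp) auto
    ultimately have "expectation (\<lambda>\<omega>. ?E s (?X t \<omega>)) / 2 - 4 * real CARD('n) * ?d
        \<le> expectation (\<lambda>\<omega>. ?E s (?X s \<omega>))" by linarith
    then have "a s / 2 * (expectation (\<lambda>\<omega>. ?E s (?X t \<omega>)) / 2 - 4 * real CARD('n) * ?d)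
        \<le> a s / 2 * expectation (\<lambda>\<omega>. ?E s (?X s \<omega>))"
      using gain_nonneg[OF s1] by (intro mult_left_mono) auto
    moreover have "a (t + N) * expectation (\<lambda>\<omega>. ?E s (?X t \<omega>)) \<le> a s * expectation (\<lambda>\<omega>. ?E s (?X t \<omega>))"
      using s s1 nonneg by (intro mult_right_mono gain_antimono) auto
    moreover have "a s * (?c * (a t)\<^sup>2) \<le> a 1 * (?c * (a t)\<^sup>2)"
      using s1 Z by (intro mult_right_mono gain_antimono) auto
    ultimately show ?thesis by (simp add: algebra_simps)
  qed
  have sum: "?v (t + d) \<le> ?v t - (\<Sum>s\<in>{t..<t + d}. a s / 2 * expectation (\<lambda>\<omega>. ?E s (?X s \<omega>)))
      + d * (noise_bound * (a t)\<^sup>2)" for d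
  proof (induction d)
    case (Suc d)
    have td: "1 \<le> t + d" using t by simp
    have "(a (t + d))\<^sup>2 * noise_bound \<le> (a t)\<^sup>2 * noise_bound"
      using noise_bound_nonneg gain_nonneg[OF td] gain_antimono[of t "t + d"] t
      by (intro mult_right_mono power_mono) auto
    with Suc expected_V_step_le[of "t + d" a x1, OF td gain_nonneg[OF td] gain_small[OF td]]
    show ?case by (simp add: algebra_simps)
  qed simp
  have "V x \<le> ?m\<^sup>2 * (\<Sum>s\<in>{t..<t + N}. ?E s x)" for x
    using V_le_edge_energy[OF conn, of x]
      mult_left_mono[OF edge_energy_UN_le[of "{t..<t + N}" "\<lambda>s. edges (G s)" x], of "?m\<^sup>2"]
    by simp
  then have "?v t \<le> expectation (\<lambda>\<omega>. ?m\<^sup>2 * (\<Sum>s\<in>{t..<t + N}. ?E s (?X t \<omega>)))"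
    unfolding expected_V_def using integrable_V[OF X] integrable_edge_energy[OF X]
    by (intro integral_mono) auto
  also have "\<dots> = ?m\<^sup>2 * (\<Sum>s\<in>{t..<t + N}. expectation (\<lambda>\<omega>. ?E s (?X t \<omega>)))"
    using integrable_edge_energy[OF X] by simp
  finally have "?v t / ?m\<^sup>2 \<le> (\<Sum>s\<in>{t..<t + N}. expectation (\<lambda>\<omega>. ?E s (?X t \<omega>)))"
    using m by (simp add: pos_divide_le_eq mult.commute)
  then have "a (t + N) / 4 * (?v t / ?m\<^sup>2) - N * (a 1 * ?c * (a t)\<^sup>2)
      \<le> a (t + N) / 4 * (\<Sum>s\<in>{t..<t + N}. expectation (\<lambda>\<omega>. ?E s (?X t \<omega>))) - N * (a 1 * ?c * (a t)\<^sup>2)"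
    using gain_nonneg[of "t + N"] t by (intro diff_right_mono mult_left_mono) auto
  also have "\<dots> = (\<Sum>s\<in>{t..<t + N}. a (t + N) / 4 * expectation (\<lambda>\<omega>. ?E s (?X t \<omega>)) - a 1 * ?c * (a t)\<^sup>2)"
    by (simp add: sum_subtractf sum_distrib_left)
  also have "\<dots> \<le> (\<Sum>s\<in>{t..<t + N}. a s / 2 * expectation (\<lambda>\<omega>. ?E s (?X s \<omega>)))"
    by (intro sum_mono dissip) auto
  finally have "?v (t + N) \<le> ?v t - (a (t + N) / 4 * (?v t / ?m\<^sup>2) - N * (a 1 * ?c * (a t)\<^sup>2))
      + N * (noise_bound * (a t)\<^sup>2)"
    using sum[of N] by linarith
  then show ?thesis by (simp add: algebra_simps)
qed

end

text \<open>
  The condition on \<open>\<tau>\<close> makes all gains small enough for the second-order term of the coupling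
  to cost at most half of the dissipation.  The condition on \<open>\<alpha>\<close> makes the contraction
  \<open>a (t + N) / (4 * (n - 1)\<^sup>2)\<close> of a window at least \<open>2 * N / (u + N)\<close> with \<open>u = t + \<tau>\<close>, which is at
  least \<open>(3 / 2) * N / u\<close> once \<open>3 * N \<le> u\<close>.
\<close>

lemma expected_V_upper_bound:
  fixes \<alpha> \<tau> :: real and N :: nat and x1 :: "real ^ 'n"
  defines "a \<equiv> \<lambda>t. \<alpha> / (real t + \<tau>)"
  assumes N: "1 \<le> N"
    and conn: "\<And>t. 1 \<le> t \<Longrightarrow> strongly_connected_edges (\<Union>s\<in>{t..<t + N}. edges (G s))"
    and \<alpha>: "8 * real N * (real CARD('n) - 1)\<^sup>2 \<le> \<alpha>"
    and \<tau>: "0 \<le> \<tau>" "2 * \<alpha> * (real CARD('n) - 1) * amax \<le> 1 + \<tau>"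
  shows "summable (\<lambda>s. (a s)\<^sup>2)"
    and "\<exists>K>0. \<exists>T\<ge>1. \<forall>t\<ge>T. expected_V M (state G w a x1) t \<le> K * (1 / real t)"
proof -
  let ?v = "expected_V M (state G w a x1)"
  let ?m = "real CARD('n) - 1"
  have m: "1 \<le> ?m" using two_nodes by simp
  have "1 \<le> ?m\<^sup>2" using m by (rule one_le_power)
  then have "0 < 8 * real N * ?m\<^sup>2" using N by (intro mult_pos_pos) auto
  then have \<alpha>_pos: "0 < \<alpha>" using \<alpha> by linarith
  have nonneg: "0 \<le> a t" for t using \<alpha>_pos \<tau> by (simp add: a_def)
  have anti: "a t \<le> a s" if "1 \<le> s" "s \<le> t" for s t
    unfolding a_def using that \<alpha>_pos \<tau> by (intro divide_left_mono mult_pos_pos) auto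
  have small: "a t * (?m * amax) \<le> 1 / 2" if "1 \<le> t" for t
  proof -
    have "2 * \<alpha> * ?m * amax \<le> real t + \<tau>" using \<tau>(2) that by simp
    then show ?thesis using that \<tau> by (simp add: a_def pos_divide_le_eq mult_ac)
  qed
  show summ: "summable (\<lambda>s. (a s)\<^sup>2)"
  proof (rule summable_comparison_test')
    show "summable (\<lambda>s. \<alpha>\<^sup>2 * inverse (real s ^ 2))"
      by (intro summable_mult inverse_power_summable) auto
    show "norm ((a s)\<^sup>2) \<le> \<alpha>\<^sup>2 * inverse (real s ^ 2)" if "1 \<le> s" for s
    proof -
      have "(a s)\<^sup>2 \<le> \<alpha>\<^sup>2 / (real s)\<^sup>2"
        unfolding a_def power_divide using that \<tau>
        by (intro divide_left_mono power_mono mult_pos_pos) auto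
      then show ?thesis by (simp add: divide_inverse)
    qed
  qed
  define K where "K = V x1 + noise_bound * (\<Sum>s. (a s)\<^sup>2)"
  have K: "?v t \<le> K" if "1 \<le> t" for t
    unfolding K_def by (intro expected_V_bounded nonneg small anti summ that)
  define R where "R = N * (noise_bound + a 1 * (2 * real CARD('n) * 4 ^ N * (2 * (coupling_bound * K + noise_bound)))) * \<alpha>\<^sup>2"
  have "0 \<le> K" using order_trans[OF expected_V_nonneg K[of 1]] by simp
  then have R: "0 \<le> R"
    unfolding R_def using coupling_bound_pos noise_bound_nonneg nonneg[of 1]
    by (intro mult_nonneg_nonneg add_nonneg_nonneg) auto
  define T where "T = 1 + 3 * N"
  have rec: "?v (t + N) \<le> (1 - 3 / 2 * real N / (real t + \<tau>)) * ?v t + R / (real t + \<tau>)\<^sup>2"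
    if t: "T \<le> t" for t
  proof -
    define u where "u = real t + \<tau>"
    have u: "3 * real N \<le> u" "0 < u" using t \<tau>(1) by (auto simp: u_def T_def)
    have "3 / 2 * real N / u \<le> 2 * real N / (u + N)"
    proof -
      have "3 * real N * real N \<le> u * real N" using u by (intro mult_right_mono) auto
      then show ?thesis using u by (simp add: field_simps)
    qed
    also have "\<dots> \<le> \<alpha> / (4 * ?m\<^sup>2) / (u + N)"
    proof (rule divide_right_mono)
      show "2 * real N \<le> \<alpha> / (4 * ?m\<^sup>2)" using \<alpha> m by (simp add: pos_le_divide_eq mult_ac)
    qed (use u in auto)
    also have "\<dots> = a (t + N) / (4 * ?m\<^sup>2)" by (simp add: a_def u_def add_ac)
    finally have "3 / 2 * real N / u \<le> a (t + N) / (4 * ?m\<^sup>2)" .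
    then have "(1 - a (t + N) / (4 * ?m\<^sup>2)) * ?v t \<le> (1 - 3 / 2 * real N / u) * ?v t"
      by (intro mult_right_mono expected_V_nonneg) auto
    moreover have "N * (noise_bound + a 1 * (2 * real CARD('n) * 4 ^ N * (2 * (coupling_bound * K + noise_bound)))) * (a t)\<^sup>2 = R / u\<^sup>2"
      by (simp add: R_def a_def u_def power_divide)
    moreover have "1 \<le> t" using t by (simp add: T_def)
    ultimately show ?thesis
      using expected_V_window_contraction[where a=a and t=t and N=N and ?x1.0=x1 and K=K, OF nonneg small anti conn K] unfolding u_def by auto
  qed
  have "3 * real N \<le> real T + \<tau>" using \<tau>(1) by (simp add: T_def)
  from rate_of_window_recursion[OF N R this rec]
  obtain K' where K': "0 < K'" "\<And>t. T \<le> t \<Longrightarrow> ?v t \<le> K' / (real t + \<tau>)" by blast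
  have "?v t \<le> K' * (1 / real t)" if "T \<le> t" for t
  proof -
    have "K' / (real t + \<tau>) \<le> K' / real t"
      using K'(1) \<tau>(1) that by (intro divide_left_mono mult_pos_pos) (auto simp: T_def)
    then show ?thesis using K'(2)[OF that] by simp
  qed
  moreover have "1 \<le> T" by (simp add: T_def)
  ultimately show "\<exists>K>0. \<exists>T\<ge>1. \<forall>t\<ge>T. ?v t \<le> K * (1 / real t)" using K'(1) by blast
qed

end

section \<open>Optimal rate and average-consensus\<close>

lemma noisy_network_of_noise_A4:
  fixes G :: "'n::finite topology"
  assumes "prob_space M" and noise: "noise_A4 M amax W" and topo: "topology_seq amax G"
    and bal: "balanced G" and "1 \<le> amax" and "2 \<le> CARD('n)"
  obtains vl vu where "noisy_network M G (W G) amax vl vu"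
proof -
  obtain vl vu where v: "0 < vl" "vl \<le> vu"
    and L2: "\<And>t j i. 1 \<le> t \<Longrightarrow> (j, i) \<in> edges (G t) \<Longrightarrow> integrable M (W G t j i) \<and>
        integrable M (\<lambda>\<omega>. (W G t j i \<omega>)\<^sup>2) \<and> (\<integral>\<omega>. W G t j i \<omega> \<partial>M) = 0"
    and uncorr: "\<And>s t j i j' i'. 1 \<le> s \<Longrightarrow> 1 \<le> t \<Longrightarrow> s \<noteq> t \<Longrightarrow> (j, i) \<in> edges (G s) \<Longrightarrow>
        (j', i') \<in> edges (G t) \<Longrightarrow> (\<integral>\<omega>. W G s j i \<omega> * W G t j' i' \<omega> \<partial>M) = 0"
    and bounds: "\<And>t (k :: 'n \<Rightarrow> 'n \<Rightarrow> real). 1 \<le> t \<Longrightarrow> edges (G t) \<noteq> {} \<Longrightarrow>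
        vl * (\<Sum>(j, i)\<in>edges (G t). (k j i)\<^sup>2)
          \<le> (\<integral>\<omega>. (\<Sum>(j, i)\<in>edges (G t). k j i * W G t j i \<omega>)\<^sup>2 \<partial>M) \<and>
        (\<integral>\<omega>. (\<Sum>(j, i)\<in>edges (G t). k j i * W G t j i \<omega>)\<^sup>2 \<partial>M)
          \<le> vu * (\<Sum>(j, i)\<in>edges (G t). (k j i)\<^sup>2)"
    using noise topo unfolding noise_A4_def by fast
  interpret prob_space M by fact
  have "noisy_network M G (W G) amax vl vu"
  proof (intro noisy_network.intro noisy_network_axioms.intro)
    show "balanced_digraph (G t) amax" if t: "1 \<le> t" for t
      by unfold_locales (use topo bal \<open>1 \<le> amax\<close> t in \<open>auto simp: topology_seq_def balanced_def\<close>)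
    show "square_integrable M (W G t j i)" if "1 \<le> t" "(j, i) \<in> edges (G t)" for t j i
      using L2[OF that] by (auto simp: square_integrable_def)
    show "expectation (W G t j i) = 0" if "1 \<le> t" "(j, i) \<in> edges (G t)" for t j i
      using L2[OF that] by simp
    show "vl * (\<Sum>(j, i)\<in>edges (G t). (k j i)\<^sup>2)
        \<le> expectation (\<lambda>\<omega>. (\<Sum>(j, i)\<in>edges (G t). k j i * W G t j i \<omega>)\<^sup>2)" if "1 \<le> t" for t k
      using bounds[OF that, of k] by (cases "edges (G t) = {}") auto
    show "expectation (\<lambda>\<omega>. (\<Sum>(j, i)\<in>edges (G t). k j i * W G t j i \<omega>)\<^sup>2)
        \<le> vu * (\<Sum>(j, i)\<in>edges (G t). (k j i)\<^sup>2)" if "1 \<le> t" for t k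
      using bounds[OF that, of k] by (cases "edges (G t) = {}") auto
  qed (use v uncorr assms in auto)
  then show thesis by (rule that)
qed

text \<open>
  From \<open>2 * m - 3 \<le> 2 * (m - 1)\<close> the threshold is at least \<open>8 * m * (m - 1)\<^sup>2 * c\<close>, and
  \<open>2 \<le> m\<close> and \<open>\<lfloor>c\<rfloor> \<le> c\<close> do the rest.
\<close>

lemma gain_threshold:
  fixes m :: nat and c \<alpha> :: real
  assumes "2 \<le> m" "1 \<le> c" "32 * real m * (real m - 1) ^ 4 * c / (2 * real m - 3)\<^sup>2 \<le> \<alpha>"
  shows "8 * real (2 * nat \<lfloor>c\<rfloor>) * (real m - 1)\<^sup>2 \<le> \<alpha>"
proof -
  let ?k = "real m - 1"
  have k: "1 \<le> ?k" using assms(1) by simp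
  have "real (2 * nat \<lfloor>c\<rfloor>) \<le> 2 * c" using assms(2) by linarith
  then have "8 * real (2 * nat \<lfloor>c\<rfloor>) * ?k\<^sup>2 \<le> 16 * c * ?k\<^sup>2" by (intro mult_right_mono) auto
  also have "\<dots> \<le> 32 * real m * ?k ^ 4 * c / (2 * real m - 3)\<^sup>2"
  proof (subst pos_le_divide_eq)
    show "0 < (2 * real m - 3)\<^sup>2" using assms(1) by simp
    have "(2 * real m - 3)\<^sup>2 \<le> (2 * ?k)\<^sup>2" using assms(1) by (intro power_mono) auto
    then have "16 * c * ?k\<^sup>2 * (2 * real m - 3)\<^sup>2 \<le> 16 * c * ?k\<^sup>2 * (2 * ?k)\<^sup>2"
      using assms(2) by (intro mult_left_mono) auto
    also have "\<dots> = 32 * 2 * ?k ^ 4 * c" by algebra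
    also have "\<dots> \<le> 32 * real m * ?k ^ 4 * c"
      using assms(1,2) by (intro mult_right_mono) auto
    finally show "16 * c * ?k\<^sup>2 * (2 * real m - 3)\<^sup>2 \<le> 32 * real m * ?k ^ 4 * c" .
  qed
  finally show ?thesis using assms(3) by linarith
qed

theorem corollary4p1:
  fixes M :: "'a measure"
    and W :: "'n::finite topology \<Rightarrow> nat \<Rightarrow> 'n \<Rightarrow> 'n \<Rightarrow> 'a \<Rightarrow> real"
    and G :: "'n topology"
    and x1 :: "real ^ 'n"
    and amax c :: real
    and n :: nat
  assumes "prob_space M"
    and "n = CARD('n)"
    and "2 \<le> n"
    and "1 \<le> amax"
    and "noise_A4 M amax W"
    and "\<exists>i j. x1 $ i \<noteq> x1 $ j"
    and "topology_seq amax G"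
    and "balanced G"
    and "1 \<le> c"
    and "uniformly_jointly_connected c G"
  shows "is_Theta (fastest_rate M G (W G) x1) (\<lambda>t. 1 / real t) \<and>
    (\<forall>(\<alpha>::real) (tstar::real).
       \<alpha> \<ge> 32 * real n * (real n - 1) ^ 4 * c / (2 * real n - 3)\<^sup>2 \<longrightarrow>
       tstar \<ge> of_int \<lfloor>2 * \<alpha> * (real n - 1) * amax\<rfloor> \<longrightarrow>
       (let x = state G (W G) (\<lambda>t. \<alpha> / (real t + tstar)) x1
        in unbiased_ms_average_consensus M x1 x \<and>
           is_Theta (expected_V M x) (\<lambda>t. 1 / real t)))"
proof -
  have "2 \<le> CARD('n)" using assms(2,3) by simp
  with assms obtain vl vu where "noisy_network M G (W G) amax vl vu"
    by (metis noisy_network_of_noise_A4)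
  then interpret noisy_network M G "W G" amax vl vu .
  define N where "N = 2 * nat \<lfloor>c\<rfloor>"
  have N: "1 \<le> N" using \<open>1 \<le> c\<close> unfolding N_def by linarith
  have conn: "strongly_connected_edges (\<Union>s\<in>{t..<t + N}. edges (G s))" if "1 \<le> t" for t
    unfolding N_def by (rule uniformly_jointly_connected_window[OF assms(10) that])
  have V1: "0 < V x1" using assms(6) by (simp add: V_pos_iff)
  define c1 where "c1 = 1 / (1 / V x1 + max_inverse_growth)"
  have c1: "0 < c1" using V1 max_inverse_growth_pos unfolding c1_def by (intro divide_pos_pos add_pos_pos) auto
  have lower: "c1 * (1 / real t) \<le> expected_V M (state G (W G) a x1) t" if "1 \<le> t" for a t
    unfolding c1_def by (rule expected_V_lower_bound[OF V1 that])
  have Theta: "is_Theta g (\<lambda>t. 1 / real t)"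
    if ge: "\<And>t. 1 \<le> t \<Longrightarrow> c1 * (1 / real t) \<le> g t"
      and le: "\<exists>K>0. \<exists>T\<ge>1. \<forall>t\<ge>T. g t \<le> K * (1 / real t)" for g
  proof -
    obtain K T where KT: "0 < K" "1 \<le> T" "\<And>t. T \<le> t \<Longrightarrow> g t \<le> K * (1 / real t)" using le by blast
    have "g t \<le> (c1 + K) * (1 / real t)" if "T \<le> t" for t
      using KT(3)[OF that] mult_right_mono[of K "c1 + K" "1 / real t"] c1 by simp
    then show ?thesis
      unfolding is_Theta_def using c1 KT ge
      by (intro exI[of _ c1] exI[of _ "c1 + K"] exI[of _ T]) auto
  qed
  have ii: "unbiased_ms_average_consensus M x1 (state G (W G) (\<lambda>t. \<alpha> / (real t + tstar)) x1) \<and>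
      0 < \<alpha> \<and> 0 \<le> tstar \<and> (\<exists>K>0. \<exists>T\<ge>1. \<forall>t\<ge>T.
        expected_V M (state G (W G) (\<lambda>t. \<alpha> / (real t + tstar)) x1) t \<le> K * (1 / real t))"
    if \<alpha>: "32 * real n * (real n - 1) ^ 4 * c / (2 * real n - 3)\<^sup>2 \<le> \<alpha>"
      and tstar: "of_int \<lfloor>2 * \<alpha> * (real n - 1) * amax\<rfloor> \<le> tstar" for \<alpha> tstar
  proof -
    let ?a = "\<lambda>t. \<alpha> / (real t + tstar)"
    let ?v = "expected_V M (state G (W G) ?a x1)"
    have \<alpha>N: "8 * real N * (real CARD('n) - 1)\<^sup>2 \<le> \<alpha>"
      using gain_threshold[OF assms(3,9) \<alpha>] assms(2) by (simp add: N_def)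
    moreover have "1 \<le> (real CARD('n) - 1)\<^sup>2" using two_nodes by (intro one_le_power) auto
    then have "0 < 8 * real N * (real CARD('n) - 1)\<^sup>2" using N by (intro mult_pos_pos) auto
    ultimately have \<alpha>_pos: "0 < \<alpha>" by linarith
    then have "0 \<le> 2 * \<alpha> * (real n - 1) * amax" using assms(3,4) by (intro mult_nonneg_nonneg) auto
    then have "0 \<le> real_of_int \<lfloor>2 * \<alpha> * (real n - 1) * amax\<rfloor>" by simp
    then have t0: "0 \<le> tstar" using tstar by linarith
    have t1: "2 * \<alpha> * (real CARD('n) - 1) * amax \<le> 1 + tstar"
    proof -
      have "r \<le> 1 + tstar" if "of_int \<lfloor>r\<rfloor> \<le> tstar" for r :: real using that by linarith
      from this[OF tstar] show ?thesis by (simp only: assms(2))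
    qed
    note upper = expected_V_upper_bound[OF N conn \<alpha>N t0 t1]
    obtain K T where KT: "1 \<le> T" "\<And>t. T \<le> t \<Longrightarrow> ?v t \<le> K * (1 / real t)" using upper(2) by blast
    have lim: "(\<lambda>t. K * (1 / real t)) \<longlonglongrightarrow> 0"
      by (intro tendsto_mult_right_zero lim_1_over_n)
    have "?v \<longlonglongrightarrow> 0"
    proof (rule tendsto_sandwich[OF _ _ tendsto_const lim])
      show "\<forall>\<^sub>F t in sequentially. ?v t \<le> K * (1 / real t)"
        using eventually_ge_at_top[of T] by eventually_elim (rule KT(2))
    qed (simp add: expected_V_nonneg)
    then show ?thesis
      using unbiased_consensus_of_V_tendsto_0[OF upper(1)] upper(2) \<alpha>_pos t0 by blast
  qed
  have "is_Theta (fastest_rate M G (W G) x1) (\<lambda>t. 1 / real t)"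
  proof (rule Theta)
    show "c1 * (1 / real t) \<le> fastest_rate M G (W G) x1 t" if "1 \<le> t" for t
      unfolding fastest_rate_def using lower[OF that] by (intro cINF_greatest) auto
    \<comment> \<open>The infimum is at most the value at the gain with the smallest admissible parameters.\<close>
    define \<alpha> where "\<alpha> = 32 * real n * (real n - 1) ^ 4 * c / (2 * real n - 3)\<^sup>2"
    define tstar where "tstar = real_of_int \<lfloor>2 * \<alpha> * (real n - 1) * amax\<rfloor>"
    let ?a = "\<lambda>t. \<alpha> / (real t + tstar)"
    obtain K T where "0 < \<alpha>" "0 \<le> tstar" and KT: "0 < K" "1 \<le> T"
      "\<And>t. T \<le> t \<Longrightarrow> expected_V M (state G (W G) ?a x1) t \<le> K * (1 / real t)"
      using ii[of \<alpha> tstar] unfolding \<alpha>_def[symmetric] tstar_def[symmetric] by blast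
    have "fastest_rate M G (W G) x1 t \<le> expected_V M (state G (W G) ?a x1) t" for t
      unfolding fastest_rate_def
      by (rule cINF_lower) (use \<open>0 < \<alpha>\<close> \<open>0 \<le> tstar\<close> expected_V_nonneg in \<open>auto intro!: bdd_belowI2[of _ 0]\<close>)
    then show "\<exists>K>0. \<exists>T\<ge>1. \<forall>t\<ge>T. fastest_rate M G (W G) x1 t \<le> K * (1 / real t)"
      using KT by (meson order_trans)
  qed
  then show ?thesis
    unfolding Let_def using ii lower Theta by auto
qed

end
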